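(* Let $r,d\in\mathbb{N}$ with $r,d\ge 1$, let $a<b$, $D>0$, let $M\subset\mathbb{R}^d$ be a nonempty open set and let $\eta\in M$. For the class of standard nonadaptive information, the $\varepsilon$-complexity of the initial-value problem $z'(t)=f(z(t))$, $t\in[a,b]$, $z(a)=\eta$, in the function class $F_{r,d}$ satisfies $$\mathrm{comp}^{\mathrm{nonad}}(\varepsilon,F_{r,d})=\Omega\left(\left(1/\varepsilon\right)^{d/r}\right)\quad\text{as }\varepsilon\to 0 .$$
   Context: Throughout, $\|\cdot\|$ is the maximum norm in $\mathbb{R}^d$, and $\mathbb{N}$ denotes the positive integers. The numbers $a<b$, the vector $\eta$, the set $M$, the number $D$, and $r,d$ are fixed; the asymptotic symbol $\Omega$ is meant as $\varepsilon\to0$, i.e. $g(\varepsilon)=\Omega(\gamma(\varepsilon))$ means that there are $C>0$ and $\varepsilon_0>0$ with $g(\varepsilon)\ge C\gamma(\varepsilon)$ for all $0<\varepsilon\le\varepsilon_0$. Function class: $$F_{r,d}=\{f:\mathbb{R}^d\to\mathbb{R}^d:\ f\in C^r(\mathbb{R}^d),\ f(y)=0\text{ for }y\notin M,\ |D^if^j(y)|\le D,\ y\in\mathbb{R}^d,\ i=0,1,\ldots,r,\ j=1,\ldots,d\},$$ where $D^if^j$ denotes any partial derivative of order $i$ of the $j$th component of $f=[f^1,\ldots,f^d]^T$. For $f\in F_{r,d}$, $z=z_f:[a,b]\to\mathbb{R}^d$ denotes the solution of $z'(t)=f(z(t))$, $t\in[a,b]$, $z(a)=\eta$. Information: for $n\in\mathbb{N}$,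 nonadaptive linear information is a vector $N_n(f)=[L_1(f),\ldots,L_n(f)]^T$, where $L_1,\ldots,L_n$ are linear functionals on the space of $C^r$ functions $f:\mathbb{R}^d\to\mathbb{R}^d$, chosen in advance, independently of $f$. It is called standard if each functional has the form $L_j(f)=D^{k_j}f^{i_j}(y_j)$, where $D^{k_j}$ is some partial derivative of order $k_j$, $0\le k_j\le r$, $1\le i_j\le d$, $y_j\in\mathbb{R}^d$ (with all $k_j$, $D^{k_j}$, $i_j$, $y_j$ fixed in advance). Algorithm and error: an algorithm is any function $\Phi_n$ which assigns to the vector $N_n(f)\in\mathbb{R}^n$ a function $l=\Phi_n(N_n(f)):[a,b]\to\mathbb{R}^d$. Its worst-case error is $$e(\Phi_n,N_n,F_{r,d})=\sup_{f\in F_{r,d}}\ \sup_{t\in[a,b]}\|z_f(t)-\Phi_n(N_n(f))(t)\| .$$ Complexity: for a given class of nonadaptive information operators, $$\mathrm{comp}^{\mathrm{nonad}}(\varepsilon,F_{r,d})=\min\{n\ge1:\ \text{there exist }N_n\text{ in the class and an algorithm }\Phi_n\text{ with }e(\Phi_n,N_n,F_{r,d})\le\varepsilon\},$$ with $\min\emptyset=+\infty$. *)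

theory Defs
  imports "HOL-Analysis.Analysis"
begin

definition partial_deriv :: "'d::finite \<Rightarrow> (real^'d \<Rightarrow> real) \<Rightarrow> real^'d \<Rightarrow> real" where
  "partial_deriv i g y = deriv (\<lambda>t. g (y + t *\<^sub>R axis i 1)) 0"

text \<open>A partial derivative of order \<open>k\<close> is given by a list of \<open>k\<close> coordinate directions;
  for functions of class \<open>C\<^sup>k\<close> the order of the list is irrelevant.\<close>

definition iter_partial :: "'d::finite list \<Rightarrow> (real^'d \<Rightarrow> real) \<Rightarrow> real^'d \<Rightarrow> real" where
  "iter_partial ks g = foldr partial_deriv ks g"

text \<open>Since \<^const>\<open>deriv\<close> is total, existence of the partial derivatives is required separately
  from their continuity.\<close>

definition C_class :: "nat \<Rightarrow> (real^'d::finite \<Rightarrow> real) \<Rightarrow> bool" where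
  "C_class r g \<longleftrightarrow>
     (\<forall>ks i y. length ks < r \<longrightarrow>
        (\<lambda>t. iter_partial ks g (y + t *\<^sub>R axis i 1)) differentiable (at 0)) \<and>
     (\<forall>ks. length ks \<le> r \<longrightarrow> continuous_on UNIV (iter_partial ks g))"

definition F_class :: "nat \<Rightarrow> real \<Rightarrow> (real^'d::finite) set \<Rightarrow> (real^'d \<Rightarrow> real^'d) set" where
  "F_class r D M = {f.
     (\<forall>j. C_class r (\<lambda>x. f x $ j)) \<and>
     (\<forall>y. y \<notin> M \<longrightarrow> f y = 0) \<and>
     (\<forall>ks j y. length ks \<le> r \<longrightarrow> \<bar>iter_partial ks (\<lambda>x. f x $ j) y\<bar> \<le> D)}"

definition solves_ivp ::
  "real \<Rightarrow> real \<Rightarrow> real^'d::finite \<Rightarrow> (real^'d \<Rightarrow> real^'d) \<Rightarrow> (real \<Rightarrow> real^'d) \<Rightarrow> bool" where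
  "solves_ivp a b \<eta> f z \<longleftrightarrow>
     z a = \<eta> \<and> (\<forall>t\<in>{a..b}. (z has_vector_derivative f (z t)) (at t within {a..b}))"

text \<open>For \<open>f \<in> F_class r D M\<close> with \<open>r \<ge> 1\<close> the right-hand side is globally Lipschitz, so a solution
  exists and its values on \<open>{a..b}\<close> are unique; only those values are used below.\<close>

definition ivp_solution ::
  "real \<Rightarrow> real \<Rightarrow> real^'d::finite \<Rightarrow> (real^'d \<Rightarrow> real^'d) \<Rightarrow> real \<Rightarrow> real^'d" where
  "ivp_solution a b \<eta> f = (SOME z. solves_ivp a b \<eta> f z)"

text \<open>Information operators are lists of functionals, the vector \<open>N\<^sub>n(f)\<close> is the list of their
  values at \<open>f\<close>.\<close>

type_synonym 'd functional = "(real^'d \<Rightarrow> real^'d) \<Rightarrow> real"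

definition info :: "'d::finite functional list \<Rightarrow> (real^'d \<Rightarrow> real^'d) \<Rightarrow> real list" where
  "info N f = map (\<lambda>L. L f) N"

text \<open>These functionals are linear on the space of functions of class \<open>C\<^sup>r\<close>; their values at other
  functions play no role.\<close>

definition standard_functional :: "nat \<Rightarrow> 'd::finite functional \<Rightarrow> bool" where
  "standard_functional r L \<longleftrightarrow>
     (\<exists>ks i y. length ks \<le> r \<and> L = (\<lambda>f. iter_partial ks (\<lambda>x. f x $ i) y))"

definition standard_info :: "nat \<Rightarrow> 'd::finite functional list set" where
  "standard_info r = {N. \<forall>L\<in>set N. standard_functional r L}"

text \<open>\<^const>\<open>infnorm\<close> is the maximum norm; the error may be infinite.\<close>

definition worst_error ::
  "real \<Rightarrow> real \<Rightarrow> real^'d::finite \<Rightarrow> (real^'d \<Rightarrow> real^'d) set \<Rightarrow>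
   'd functional list \<Rightarrow> (real list \<Rightarrow> real \<Rightarrow> real^'d) \<Rightarrow> ereal" where
  "worst_error a b \<eta> F N \<Phi> =
     (SUP f\<in>F. SUP t\<in>{a..b}. ereal (infnorm (ivp_solution a b \<eta> f t - \<Phi> (info N f) t)))"

text \<open>The infimum in \<^typ>\<open>enat\<close> is attained for a nonempty set and is \<open>\<infinity>\<close> for the empty set.\<close>

definition comp_nonad ::
  "real \<Rightarrow> real \<Rightarrow> real^'d::finite \<Rightarrow> (real^'d \<Rightarrow> real^'d) set \<Rightarrow>
   'd functional list set \<Rightarrow> real \<Rightarrow> enat" where
  "comp_nonad a b \<eta> F \<N> \<epsilon> =
     Inf {enat n | n. n \<ge> 1 \<and>
       (\<exists>N\<in>\<N>. length N = n \<and> (\<exists>\<Phi>. worst_error a b \<eta> F N \<Phi> \<le> ereal \<epsilon>))}"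

end

(* Constant vector fields delta * v near \<eta> send the solution along the ray from \<eta> in direction v.
   Along K^(d-1) such rays place K disjoint cubes each, of side proportional to 1/K. If 2n <= K^d,
   some ray has at least K/2 cubes containing no sample point; accelerating the flow there by a
   smooth bump of height proportional to K^(-r) does not change the information, keeps the solution
   on the same ray, and shifts it by an amount proportional to K^(-r): K/2 cubes, each of
   length about 1/K, each contribute about K^(-r-1). *)

theory Submission imports Defs begin

text \<open>A trajectory crosses only about \<open>K\<close> cubes, so if \<open>v\<close> were
  known in advance, about \<open>K\<close> samples would hit all of them. Nonadaptivity gives the
  exponent its factor d: the functionals are fixed before \<open>v\<close> is chosen, so they have
  to guard every ray. Both fooling fields, perturbed and unperturbed, are multiples of the same
  \<open>v\<close>. Their solutions run along the same line and differ only in parametrization,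
  which leaves a scalar autonomous equation. All rays leave \<eta> and crowd together near it. The
  cubes therefore occupy only the outer half of a segment of length \<open>R\<close>, where cubes of
  different rays are disjoint. A constant field is not in the class, since it must vanish outside
  \<open>M\<close>; it is cut off by a wide bump around \<eta>. The base speed \<delta> is so small
  that even at twice that speed the solution stays on the plateau of this cut-off during the whole
  time interval. The bump height is of the order that derivatives of order \<open>r\<close> allow at
  width proportional to 1/K.\<close>

section \<open>One-dimensional smooth steps and bumps\<close>

lemma continuous_antiderivative:
  fixes f :: "real \<Rightarrow> real"
  assumes "continuous_on UNIV f"
  obtains A where "\<And>x. (A has_real_derivative f x) (at x)"
proof -
  have "\<exists>F. \<forall>x :: real. (-\<infinity> :: ereal) < x \<longrightarrow> x < (\<infinity> :: ereal) \<longrightarrow> (F has_vector_derivative f x) (at x)"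
    using assms by (intro einterval_antiderivative) (auto simp: continuous_on_eq_continuous_at)
  then show thesis
    using that by (auto simp: has_real_derivative_iff_has_vector_derivative)
qed

text \<open>The sequence \<open>S k\<close> plays the role of the derivatives of \<open>S 0\<close>. The induction passes to the
  moving average over a unit interval, whose derivative is \<open>S 0 x - S 0 (x - 1)\<close>.\<close>

lemma smooth_step_family:
  "\<exists>S :: nat \<Rightarrow> real \<Rightarrow> real. \<exists>L B. L > 0 \<and>
     (\<forall>k<r. \<forall>x. (S k has_real_derivative S (Suc k) x) (at x)) \<and>
     (\<forall>k. continuous_on UNIV (S k)) \<and>
     (\<forall>k x. \<bar>S k x\<bar> \<le> B) \<and>
     (\<forall>x. 0 \<le> S 0 x \<and> S 0 x \<le> 1) \<and>
     (\<forall>k x. x \<le> 0 \<longrightarrow> S k x = 0) \<and>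
     (\<forall>k x. x \<ge> L \<longrightarrow> S k x = (if k = 0 then 1 else 0))"
proof (induction r)
  case 0
  have "continuous_on UNIV (\<lambda>x::real. if k = 0 then max 0 (min 1 x) else 0)" for k :: nat
    by (cases "k = 0") (auto intro!: continuous_intros)
  then show ?case
    \<comment> \<open>For \<open>r = 0\<close> no derivative is demanded, so a continuous ramp
      suffices and the higher entries may be zero.\<close>
    by (intro exI[of _ "\<lambda>k x. if k = 0 then max 0 (min 1 x) else 0"] exI[of _ 1]) auto
next
  case (Suc r)
  then obtain S :: "nat \<Rightarrow> real \<Rightarrow> real" and L B where L: "L > 0"
    and der: "\<And>k x. k < r \<Longrightarrow> (S k has_real_derivative S (Suc k) x) (at x)"
    and cont: "\<And>k. continuous_on UNIV (S k)"
    and bd: "\<And>k x. \<bar>S k x\<bar> \<le> B"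
    and S01: "\<And>x. 0 \<le> S 0 x" "\<And>x. S 0 x \<le> 1"
    and left: "\<And>k x. x \<le> 0 \<Longrightarrow> S k x = 0"
    and right: "\<And>k x. x \<ge> L \<Longrightarrow> S k x = (if k = 0 then 1 else 0)"
    by metis
  obtain A where A: "\<And>x. (A has_real_derivative S 0 x) (at x)"
    using continuous_antiderivative[OF cont] by metis
  have contA: "continuous_on UNIV A"
    using A by (meson DERIV_isCont continuous_at_imp_continuous_on)
  define S' where "S' k x = (case k of 0 \<Rightarrow> A x - A (x - 1) | Suc k \<Rightarrow> S k x - S k (x - 1))" for k x
  \<comment> \<open>The average over (x - 1, x) is a value of \<open>S 0\<close> there. This one
    fact yields the range [0, 1] and both constant tails, the right one starting at
    \<open>L + 1\<close>.\<close>
  have mean: "\<exists>\<xi>. x - 1 < \<xi> \<and> \<xi> < x \<and> S' 0 x = S 0 \<xi>" for x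
    using MVT2[of "x - 1" x A "S 0"] A by (auto simp: S'_def)
  have shift: "((\<lambda>x. g (x - 1)) has_real_derivative g' (x - 1)) (at x)"
    if "\<And>x. (g has_real_derivative g' x) (at x)" for g g' :: "real \<Rightarrow> real" and x
    by (rule DERIV_chain2[THEN DERIV_cong, OF that]) (auto intro!: derivative_eq_intros)
  have "(S' k has_real_derivative S' (Suc k) x) (at x)" if "k < Suc r" for k x
  proof (cases k)
    case 0
    show ?thesis unfolding 0 S'_def by (auto intro!: DERIV_diff A shift)
  next
    case (Suc j)
    with that show ?thesis unfolding Suc S'_def by (auto intro!: DERIV_diff der shift)
  qed
  moreover have "continuous_on UNIV (S' k)" for k
    by (cases k) (auto simp: S'_def intro!: continuous_intros continuous_on_compose2[OF cont]
        continuous_on_compose2[OF contA])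
  moreover have "\<bar>S' k x\<bar> \<le> 2 * B" for k x
  proof (cases k)
    case 0
    obtain \<xi> where "S' 0 x = S 0 \<xi>" using mean by blast
    with bd[of 0 \<xi>] 0 show ?thesis by auto
  next
    case (Suc j)
    with bd[of j x] bd[of j "x - 1"] show ?thesis by (auto simp: S'_def)
  qed
  moreover have "0 \<le> S' 0 x \<and> S' 0 x \<le> 1" for x
    using mean[of x] S01 by auto
  moreover have "S' k x = 0" if "x \<le> 0" for k x
  proof (cases k)
    case 0
    with mean[of x] left that show ?thesis by force
  next
    case (Suc j)
    with left that show ?thesis by (auto simp: S'_def)
  qed
  moreover have "S' k x = (if k = 0 then 1 else 0)" if "x \<ge> L + 1" for k x
  proof (cases k)
    case 0
    with mean[of x] right that show ?thesis by force
  next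
    case (Suc j)
    with right that show ?thesis by (auto simp: S'_def)
  qed
  ultimately show ?case
    using L by (intro exI[of _ S'] exI[of _ "L + 1"] exI[of _ "2 * B"]) auto
qed

text \<open>The plateau of positive half-width \<kappa> serves twice: it makes the cut-off field
  exactly constant near \<eta>, and it gives a stretch of known length on which a small bump has its
  full height.\<close>

locale bump_family =
  fixes r :: nat and \<Theta> :: "nat \<Rightarrow> real \<Rightarrow> real" and \<kappa> B :: real
  assumes deriv: "k < r \<Longrightarrow> (\<Theta> k has_real_derivative \<Theta> (Suc k) x) (at x)"
    and cont: "continuous_on UNIV (\<Theta> k)"
    and bound: "k \<le> r \<Longrightarrow> \<bar>\<Theta> k x\<bar> \<le> B"
    and vanish: "\<bar>x\<bar> \<ge> 1 \<Longrightarrow> \<Theta> k x = 0"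
    and plateau: "\<bar>x\<bar> \<le> \<kappa> \<Longrightarrow> \<Theta> 0 x = 1"
    and nonneg: "0 \<le> \<Theta> 0 x"
    and le_one: "\<Theta> 0 x \<le> 1"
    and kappa_pos: "0 < \<kappa>"

text \<open>A bump is a rising step minus a later one. With \<open>l = L + 1\<close> the rise takes
  place on [-1, -1/l] and the fall on [1/l, 1], which leaves a plateau of half-width 1/l.\<close>

lemma bump_family_exists: "\<exists>\<Theta> \<kappa> B. bump_family r \<Theta> \<kappa> B"
proof -
  obtain S :: "nat \<Rightarrow> real \<Rightarrow> real" and L B where L: "L > 0"
    and der: "\<And>k x. k < r \<Longrightarrow> (S k has_real_derivative S (Suc k) x) (at x)"
    and cont: "\<And>k. continuous_on UNIV (S k)"
    and bd: "\<And>k x. \<bar>S k x\<bar> \<le> B"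
    and S01: "\<And>x. 0 \<le> S 0 x" "\<And>x. S 0 x \<le> 1"
    and left: "\<And>k x. x \<le> 0 \<Longrightarrow> S k x = 0"
    and right: "\<And>k x. x \<ge> L \<Longrightarrow> S k x = (if k = 0 then 1 else 0)"
    using smooth_step_family[of r] by metis
  define l where "l = L + 1"
  have l: "l > 1" using L by (simp add: l_def)
  define \<Theta> where "\<Theta> k x = l ^ k * (S k (l * x + l) - S k (l * x - 1))" for k x
  have "bump_family r \<Theta> (1 / l) (l ^ r * (2 * B))"
  proof
    fix k x assume "k < r"
    have chain: "((\<lambda>x. S k (l * x + c)) has_real_derivative S (Suc k) (l * x + c) * l) (at x)" for c
      by (rule DERIV_chain2[OF der[OF \<open>k < r\<close>]]) (auto intro!: derivative_eq_intros)
    from DERIV_cmult[OF DERIV_diff[OF chain[of l] chain[of "-1"]], of "l ^ k"]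
    show "(\<Theta> k has_real_derivative \<Theta> (Suc k) x) (at x)"
      unfolding \<Theta>_def by (simp add: algebra_simps)
  next
    fix k show "continuous_on UNIV (\<Theta> k)" unfolding \<Theta>_def
      by (auto intro!: continuous_intros continuous_on_compose2[OF cont])
  next
    fix k x assume k: "k \<le> r"
    have "\<bar>S k (l * x + l) - S k (l * x - 1)\<bar> \<le> 2 * B"
      using bd[of k "l * x + l"] bd[of k "l * x - 1"] by linarith
    moreover have "l ^ k \<le> l ^ r" using l k by (intro power_increasing) auto
    ultimately show "\<bar>\<Theta> k x\<bar> \<le> l ^ r * (2 * B)"
      unfolding \<Theta>_def abs_mult using l by (intro mult_mono) auto
  next
    fix k and x :: real assume "\<bar>x\<bar> \<ge> 1"
    then consider "x \<ge> 1" | "x \<le> -1" by linarith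
    then show "\<Theta> k x = 0"
    proof cases
      case 1
      then have "l * x \<ge> l * 1" using l by (intro mult_left_mono) auto
      then show ?thesis using right[of "l * x + l"] right[of "l * x - 1"] l by (auto simp: \<Theta>_def l_def)
    next
      case 2
      then have "l * x \<le> l * (-1)" using l by (intro mult_left_mono) auto
      then show ?thesis using left[of "l * x + l"] left[of "l * x - 1"] l by (auto simp: \<Theta>_def)
    qed
  next
    fix x :: real assume "\<bar>x\<bar> \<le> 1 / l"
    then have "\<bar>l * x\<bar> \<le> 1" using l by (simp add: abs_mult field_simps)
    then show "\<Theta> 0 x = 1"
      using right[of "l * x + l" 0] left[of "l * x - 1" 0] by (auto simp: \<Theta>_def l_def)
  next
    fix x
    \<comment> \<open>The rise is complete before the fall begins, so the difference is never
      negative.\<close>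
    have "l * x - 1 \<le> 0 \<or> l * x + l \<ge> L" unfolding l_def by linarith
    then show "0 \<le> \<Theta> 0 x"
      using left[of "l * x - 1" 0] right[of "l * x + l" 0] S01 l by (auto simp: \<Theta>_def)
    show "\<Theta> 0 x \<le> 1"
      using S01(1)[of "l * x - 1"] S01(2)[of "l * x + l"] by (auto simp: \<Theta>_def)
  next
    show "0 < 1 / l" using l by simp
  qed
  then show ?thesis by blast
qed

context bump_family begin

lemma bound_ge_one: "1 \<le> B"
  using plateau[of 0] bound[of 0 0] kappa_pos by auto

lemma kappa_less_one: "\<kappa> < 1"
  using plateau[of 1] vanish[of 1 0] by force

end

section \<open>Bumps in several variables and their partial derivatives\<close>

text \<open>\<open>G ks\<close> is the iterated partial derivative of \<open>G []\<close> along \<open>ks\<close>.\<close>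

definition partials :: "nat \<Rightarrow> ('d::finite list \<Rightarrow> real^'d \<Rightarrow> real) \<Rightarrow> bool" where
  "partials r G \<longleftrightarrow>
     (\<forall>ks i y. length ks < r \<longrightarrow>
        ((\<lambda>t. G ks (y + t *\<^sub>R axis i 1)) has_real_derivative G (i # ks) y) (at 0)) \<and>
     (\<forall>ks. continuous_on UNIV (G ks))"

lemma partials_iter_partial:
  assumes "partials r G" "length ks \<le> r"
  shows "iter_partial ks (G []) = G ks"
  using assms(2)
proof (induction ks)
  case Nil
  show ?case by (simp add: iter_partial_def)
next
  case (Cons i ks)
  then have "iter_partial (i # ks) (G []) = partial_deriv i (G ks)"
    by (simp add: iter_partial_def)
  also have "\<dots> = G (i # ks)"
    using assms(1) Cons.prems
    by (auto simp: partials_def partial_deriv_def fun_eq_iff intro!: DERIV_imp_deriv)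
  finally show ?case .
qed

lemma partials_C_class:
  assumes "partials r G"
  shows "C_class r (G [])"
  using assms partials_iter_partial[OF assms]
  unfolding C_class_def partials_def real_differentiable_def by (metis less_imp_le)

lemma partials_add:
  "partials r F \<Longrightarrow> partials r G \<Longrightarrow> partials r (\<lambda>ks x. F ks x + G ks x)"
  unfolding partials_def by (auto intro!: DERIV_add continuous_intros)

lemma partials_cmult:
  "partials r G \<Longrightarrow> partials r (\<lambda>ks x. c * G ks x)"
  unfolding partials_def by (auto intro!: DERIV_cmult continuous_intros)

lemma partials_sum:
  assumes "\<And>k. k \<in> A \<Longrightarrow> partials r (G k)"
  shows "partials r (\<lambda>ks x. \<Sum>k\<in>A. G k ks x)"
  using assms unfolding partials_def by (auto intro!: DERIV_sum continuous_intros)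

context bump_family begin

text \<open>A closed form for all partial derivatives of a product bump: each differentiation along
  \<open>j\<close> raises the index of the factor for \<open>j\<close> by one and brings out a
  factor 1/\<rho>.\<close>

definition bump :: "real \<Rightarrow> real^'d \<Rightarrow> 'd::finite list \<Rightarrow> real^'d \<Rightarrow> real" where
  "bump \<rho> c ks x = (\<Prod>j\<in>UNIV. \<Theta> (count_list ks j) ((x $ j - c $ j) / \<rho>)) / \<rho> ^ length ks"

lemma partials_bump:
  fixes c :: "real^'d::finite"
  assumes "\<rho> > 0"
  shows "partials r (bump \<rho> c)"
  unfolding partials_def
proof (intro conjI allI impI)
  fix ks :: "'d list" and i :: 'd and y :: "real^'d"
  assume len: "length ks < r"
  have cnt: "count_list ks i < r" using len count_le_length[of ks i] by simp
  define P where "P = (\<Prod>j\<in>UNIV - {i}. \<Theta> (count_list ks j) ((y $ j - c $ j) / \<rho>))"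
  have split: "(\<Prod>j\<in>UNIV. h j) = h i * (\<Prod>j\<in>UNIV - {i}. h j)" for h :: "'d \<Rightarrow> real"
    by (simp add: prod.remove)
  have 1: "bump \<rho> c ks (y + t *\<^sub>R axis i 1)
      = \<Theta> (count_list ks i) ((y $ i + t - c $ i) / \<rho>) * (P / \<rho> ^ length ks)" for t
    unfolding bump_def split P_def by (simp add: axis_def)
  \<comment> \<open>The summand 0 stands for \<open>t = 0\<close> in the inner function, so that the
    chain rule applies literally.\<close>
  have 2: "bump \<rho> c (i # ks) y
      = \<Theta> (Suc (count_list ks i)) ((y $ i + 0 - c $ i) / \<rho>) * (1 / \<rho>) * (P / \<rho> ^ length ks)"
    unfolding bump_def split P_def by simp
  have "((\<lambda>t. \<Theta> (count_list ks i) ((y $ i + t - c $ i) / \<rho>))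
      has_real_derivative \<Theta> (Suc (count_list ks i)) ((y $ i + 0 - c $ i) / \<rho>) * (1 / \<rho>)) (at 0)"
    by (rule DERIV_chain2[OF deriv[OF cnt]]) (use assms in \<open>auto intro!: derivative_eq_intros\<close>)
  then show "((\<lambda>t. bump \<rho> c ks (y + t *\<^sub>R axis i 1)) has_real_derivative bump \<rho> c (i # ks) y) (at 0)"
    unfolding 1 2 by (rule DERIV_cmult_right)
next
  fix ks :: "'d list"
  show "continuous_on UNIV (bump \<rho> c ks)"
    unfolding bump_def using assms
    by (auto intro!: continuous_intros continuous_on_compose2[OF cont])
qed

lemma bump_vanish:
  assumes "\<rho> > 0" "\<bar>x $ j - c $ j\<bar> \<ge> \<rho>"
  shows "bump \<rho> c ks x = 0"
  unfolding bump_def using assms by (auto intro!: exI[of _ j] vanish)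

lemma bump_plateau:
  assumes "\<rho> > 0" "\<And>j. \<bar>x $ j - c $ j\<bar> \<le> \<kappa> * \<rho>"
  shows "bump \<rho> c [] x = 1"
  unfolding bump_def using assms by (auto intro!: prod.neutral plateau simp: field_simps)

lemma bump_nonneg: "0 \<le> bump \<rho> c [] x"
  unfolding bump_def by (auto intro!: prod_nonneg nonneg)

lemma bump_le_one: "bump \<rho> c [] x \<le> 1"
  unfolding bump_def by (auto intro!: prod_le_1 nonneg le_one)

text \<open>This is why perturbations carry the factor \<open>\<rho> ^ r\<close>: differentiating
  costs at most \<open>r\<close> factors 1/\<rho>, and \<rho> at most 1 makes the surplus factors
  harmless at lower orders. The bound is uniform in \<rho>.\<close>

lemma abs_bump_le:
  fixes c :: "real^'d::finite"
  assumes "\<rho> > 0" "\<rho> \<le> 1" "length ks \<le> r"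
  shows "\<bar>bump \<rho> c ks x\<bar> * \<rho> ^ r \<le> B ^ CARD('d)"
proof -
  have "\<bar>bump \<rho> c ks x\<bar> * \<rho> ^ r
      = (\<Prod>j\<in>UNIV. \<bar>\<Theta> (count_list ks j) ((x $ j - c $ j) / \<rho>)\<bar>) * \<rho> ^ (r - length ks)"
    using assms by (simp add: bump_def abs_mult abs_prod power_diff)
  also have "\<dots> \<le> (\<Prod>j\<in>(UNIV :: 'd set). B) * 1"
  proof (intro mult_mono prod_mono conjI bound)
    show "count_list ks j \<le> r" for j using assms(3) count_le_length[of ks j] by simp
  qed (use assms bound_ge_one in \<open>auto intro!: power_le_one prod_nonneg\<close>)
  finally show ?thesis by simp
qed

end

section \<open>Uniqueness of solutions and the fooling principle\<close>

text \<open>\<open>C_class\<close> supplies derivatives along coordinate axes, so the passage from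
  \<open>y\<close> to \<open>x\<close> changes one coordinate at a time, each change being
  controlled by a one-dimensional mean value bound.\<close>

lemma F_class_Lipschitz:
  fixes f :: "real^'d::finite \<Rightarrow> real^'d"
  assumes f: "f \<in> F_class r D M" and r: "r \<ge> 1"
  obtains L where "L \<ge> 0" "\<And>x y. norm (f x - f y) \<le> L * norm (x - y)"
proof -
  have coord: "\<bar>f x $ j - f y $ j\<bar> \<le> (\<Sum>i\<in>UNIV. D * \<bar>x $ i - y $ i\<bar>)" for x y j
  proof -
    let ?g = "\<lambda>x. f x $ j"
    have C: "C_class r ?g" and bd: "\<And>ks z. length ks \<le> r \<Longrightarrow> \<bar>iter_partial ks ?g z\<bar> \<le> D"
      using f by (auto simp: F_class_def)
    have line: "\<bar>?g (z + s *\<^sub>R axis i 1) - ?g z\<bar> \<le> D * \<bar>s\<bar>" for z i s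
    proof -
      have der: "((\<lambda>t. ?g (z + t *\<^sub>R axis i 1)) has_real_derivative
          iter_partial [i] ?g (z + t *\<^sub>R axis i 1)) (at t)" for t
      proof -
        have "(\<lambda>u. iter_partial [] ?g ((z + t *\<^sub>R axis i 1) + u *\<^sub>R axis i 1)) differentiable (at 0)"
          using C[unfolded C_class_def, THEN conjunct1, rule_format, of "[]" "z + t *\<^sub>R axis i 1" i] r
          by simp
        then have "((\<lambda>u. ?g ((z + t *\<^sub>R axis i 1) + u *\<^sub>R axis i 1)) has_real_derivative
            iter_partial [i] ?g (z + t *\<^sub>R axis i 1)) (at 0)"
          by (simp add: iter_partial_def partial_deriv_def DERIV_deriv_iff_real_differentiable)
        then show ?thesis
          using DERIV_shift[of "\<lambda>u. ?g (z + u *\<^sub>R axis i 1)" _ 0 t] by (simp add: algebra_simps)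
      qed
      show ?thesis
        using field_differentiable_bound[OF convex_UNIV, where f = "\<lambda>t. ?g (z + t *\<^sub>R axis i 1)"
            and f' = "\<lambda>t. iter_partial [i] ?g (z + t *\<^sub>R axis i 1)" and B = D and x = s and y = 0] der bd[of "[i]"] r by simp
    qed
    \<comment> \<open>\<open>A\<close> collects the coordinates already switched from
      \<open>y\<close> to \<open>x\<close>.\<close>
    have "\<bar>?g (\<chi> i. if i \<in> A then x $ i else y $ i) - ?g y\<bar> \<le> (\<Sum>i\<in>A. D * \<bar>x $ i - y $ i\<bar>)"
      if "finite A" for A
      using that
    proof (induction A)
      case empty
      show ?case by simp
    next
      case (insert i A)
      let ?z = "\<chi> i. if i \<in> A then x $ i else y $ i"
      have "(\<chi> k. if k \<in> insert i A then x $ k else y $ k) = ?z + (x $ i - y $ i) *\<^sub>R axis i 1"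
        using insert.hyps by (auto simp: vec_eq_iff axis_def)
      then have "\<bar>?g (\<chi> k. if k \<in> insert i A then x $ k else y $ k) - ?g ?z\<bar> \<le> D * \<bar>x $ i - y $ i\<bar>"
        using line[of ?z "x $ i - y $ i" i] by metis
      with insert show ?case by simp
    qed
    from this[of UNIV] show ?thesis by simp
  qed
  have "\<bar>iter_partial [] (\<lambda>x. f x $ undefined) 0\<bar> \<le> D"
    using f unfolding F_class_def mem_Collect_eq by (elim conjE) simp
  then have D: "D \<ge> 0" by linarith
  have "norm (f x - f y) \<le> (real CARD('d) * real CARD('d) * D) * norm (x - y)" for x y
  proof -
    have "norm (f x - f y) \<le> (\<Sum>j\<in>UNIV. \<bar>(f x - f y) $ j\<bar>)" by (rule norm_le_l1_cart)
    also have "\<dots> \<le> (\<Sum>j\<in>(UNIV::'d set). \<Sum>i\<in>(UNIV::'d set). D * norm (x - y))"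
    proof (intro sum_mono)
      fix j :: 'd
      have "\<bar>(f x - f y) $ j\<bar> \<le> (\<Sum>i\<in>UNIV. D * \<bar>x $ i - y $ i\<bar>)" using coord by simp
      also have "\<dots> \<le> (\<Sum>i\<in>(UNIV::'d set). D * norm (x - y))"
        using D component_le_norm_cart[of "x - y"] by (intro sum_mono mult_left_mono) auto
      finally show "\<bar>(f x - f y) $ j\<bar> \<le> (\<Sum>i\<in>(UNIV::'d set). D * norm (x - y))" .
    qed
    finally show ?thesis by simp
  qed
  with D show thesis by (intro that[of "real CARD('d) * real CARD('d) * D"]) auto
qed

text \<open>Gronwall's argument: weighting the squared distance by \<open>exp (- 2 * L * t)\<close>
  makes it nonincreasing, and it starts at 0.\<close>

lemma solves_ivp_unique:
  assumes z: "solves_ivp a b \<eta> f z" and w: "solves_ivp a b \<eta> f w"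
    and L: "\<And>x y. norm (f x - f y) \<le> L * norm (x - y)"
    and t: "t \<in> {a..b}"
  shows "z t = w t"
proof -
  define u where "u t = exp (- 2 * L * t) * ((z t - w t) \<bullet> (z t - w t))" for t
  define u' where "u' t = exp (- 2 * L * t) *
    (2 * ((z t - w t) \<bullet> (f (z t) - f (w t))) - 2 * L * ((z t - w t) \<bullet> (z t - w t)))" for t
  have der: "(u has_vector_derivative u' s) (at s within {a..b})" if "s \<in> {a..b}" for s
  proof -
    have zw: "((\<lambda>t. z t - w t) has_vector_derivative (f (z s) - f (w s))) (at s within {a..b})"
      using z w that by (auto simp: solves_ivp_def intro!: derivative_intros)
    have e: "((\<lambda>t. exp (- 2 * L * t)) has_vector_derivative (- 2 * L * exp (- 2 * L * s))) (at s within {a..b})"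
      unfolding has_real_derivative_iff_has_vector_derivative[symmetric]
      by (auto intro!: derivative_eq_intros)
    from has_vector_derivative_mult[OF e bounded_bilinear.has_vector_derivative[OF bounded_bilinear_inner zw zw]]
    show ?thesis unfolding u_def u'_def
      by (simp add: inner_commute[of "f (z s) - f (w s)"] right_diff_distrib mult_ac)
  qed
  have neg: "u' s \<le> 0" for s
  proof -
    have "(z s - w s) \<bullet> (f (z s) - f (w s)) \<le> norm (z s - w s) * norm (f (z s) - f (w s))"
      by (rule norm_cauchy_schwarz)
    also have "\<dots> \<le> norm (z s - w s) * (L * norm (z s - w s))"
      by (intro mult_left_mono L) auto
    also have "\<dots> = L * ((z s - w s) \<bullet> (z s - w s))"
      by (simp add: power2_norm_eq_inner[symmetric] power2_eq_square)
    finally show ?thesis unfolding u'_def by (intro mult_nonneg_nonpos) auto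
  qed
  have "u t \<le> u a"
  proof (rule DERIV_nonpos_imp_decreasing_open[where f = u])
    show "a \<le> t" using t by simp
    show "\<exists>y. (u has_real_derivative y) (at s) \<and> y \<le> 0" if "a < s" "s < t" for s
    proof -
      have "(u has_vector_derivative u' s) (at s)"
        using der[of s] that t by (simp add: at_within_Icc_at)
      with neg show ?thesis by (auto simp: has_real_derivative_iff_has_vector_derivative)
    qed
    show "continuous_on {a..t} u"
    proof (rule continuous_on_subset)
      show "continuous_on {a..b} u"
        unfolding continuous_on_eq_continuous_within
        using der has_vector_derivative_continuous by blast
    qed (use t in auto)
  qed
  also have "u a = 0" using z w by (simp add: u_def solves_ivp_def)
  finally have "(z t - w t) \<bullet> (z t - w t) \<le> 0"
    unfolding u_def by (meson exp_gt_zero mult_pos_pos not_le)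
  then have "(z t - w t) \<bullet> (z t - w t) = 0" by (meson inner_ge_zero order_antisym)
  then show ?thesis by simp
qed

text \<open>\<open>ivp_solution\<close> is a Hilbert choice, so an explicit solution can be
  identified with it only through uniqueness, hence only on [a, b].\<close>

lemma ivp_solution_eq:
  assumes "f \<in> F_class r D M" "r \<ge> 1" "solves_ivp a b \<eta> f z" "t \<in> {a..b}"
  shows "ivp_solution a b \<eta> f t = z t"
proof -
  obtain L where L: "\<And>x y. norm (f x - f y) \<le> L * norm (x - y)"
    using F_class_Lipschitz[OF assms(1,2)] by metis
  have "solves_ivp a b \<eta> f (ivp_solution a b \<eta> f)"
    unfolding ivp_solution_def by (rule someI[of "solves_ivp a b \<eta> f", OF assms(3)])
  from solves_ivp_unique[OF this assms(3) L assms(4)] show ?thesis .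
qed

text \<open>Equal information forces equal output of \<Phi>, and this single output must be within
  \<epsilon> of both solutions.\<close>

lemma worst_error_fooling:
  assumes "f \<in> F" "g \<in> F" "info N f = info N g" "worst_error a b \<eta> F N \<Phi> \<le> ereal \<epsilon>"
    and "t \<in> {a..b}"
  shows "\<bar>ivp_solution a b \<eta> f t $ i - ivp_solution a b \<eta> g t $ i\<bar> \<le> 2 * \<epsilon>"
proof -
  have le: "\<bar>ivp_solution a b \<eta> h t $ i - \<Phi> (info N h) t $ i\<bar> \<le> \<epsilon>" if "h \<in> F" for h
  proof -
    have "ereal (infnorm (ivp_solution a b \<eta> h t - \<Phi> (info N h) t)) \<le> worst_error a b \<eta> F N \<Phi>"
      unfolding worst_error_def by (rule SUP_upper2[OF that]) (rule SUP_upper2[OF assms(5)], simp)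
    with assms(4) have "infnorm (ivp_solution a b \<eta> h t - \<Phi> (info N h) t) \<le> \<epsilon>"
      by (metis ereal_less_eq(3) order_trans)
    with component_le_infnorm_cart[of "ivp_solution a b \<eta> h t - \<Phi> (info N h) t" i]
    show ?thesis by simp
  qed
  show ?thesis using le[OF assms(1)] le[OF assms(2)] assms(3) by simp
qed

section \<open>Scalar autonomous equations\<close>

text \<open>Separation of variables: \<open>\<zeta>\<close> is the inverse of the travel time \<open>\<tau>\<close>.\<close>

lemma autonomous_scalar_solution:
  fixes F :: "real \<Rightarrow> real"
  assumes cont: "continuous_on UNIV F" and lo: "\<And>s. \<delta> \<le> F s" and hi: "\<And>s. F s \<le> E"
    and pos: "\<delta> > 0"
  obtains \<zeta> \<tau> where
    "\<And>t. (\<zeta> has_real_derivative F (\<zeta> t)) (at t)" "\<And>s. (\<tau> has_real_derivative 1 / F s) (at s)"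
    "\<And>s. \<zeta> (\<tau> s) = s" "\<zeta> 0 = 0" "\<tau> 0 = 0"
proof -
  have Fpos: "F s > 0" for s using lo[of s] pos by simp
  have Epos: "E > 0" using Fpos[of 0] hi[of 0] by simp
  have "continuous_on UNIV (\<lambda>s. 1 / F s)"
    using Fpos by (intro continuous_intros cont) (auto simp: less_imp_neq[symmetric])
  then obtain A where A: "\<And>s. (A has_real_derivative 1 / F s) (at s)"
    using continuous_antiderivative by metis
  define \<tau> where "\<tau> s = A s - A 0" for s
  have der: "(\<tau> has_real_derivative 1 / F s) (at s)" for s
    unfolding \<tau>_def by (auto intro!: derivative_eq_intros A)
  \<comment> \<open>The upper bound on the speed makes \<tau> grow at least linearly. This gives
    surjectivity of \<tau> and Lipschitz continuity of its inverse.\<close>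
  have growth: "(s' - s) / E \<le> \<tau> s' - \<tau> s" if "s \<le> s'" for s s'
  proof (cases "s = s'")
    case False
    with that have "s < s'" by simp
    then obtain x where "\<tau> s' - \<tau> s = (s' - s) * (1 / F x)"
      using MVT2[of s s' \<tau> "\<lambda>s. 1 / F s"] der by blast
    moreover have "1 / E \<le> 1 / F x" using hi Fpos by (intro divide_left_mono) (auto simp: Epos)
    ultimately show ?thesis using that mult_left_mono[of "1 / E" "1 / F x" "s' - s"] by simp
  qed simp
  have expand: "\<bar>s' - s\<bar> \<le> E * \<bar>\<tau> s' - \<tau> s\<bar>" for s s'
  proof -
    have "\<bar>s' - s\<bar> / E \<le> \<bar>\<tau> s' - \<tau> s\<bar>"
      using growth[of s s'] growth[of s' s] by (cases "s \<le> s'") auto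
    then show ?thesis using Epos by (simp add: pos_divide_le_eq mult.commute)
  qed
  have inj: "inj \<tau>"
  proof (rule injI)
    show "s = s'" if "\<tau> s = \<tau> s'" for s s' using expand[of s' s] that by simp
  qed
  have "surj \<tau>"
  proof -
    have "\<exists>s. \<tau> s = y" for y
    proof -
      have "\<tau> (- E * \<bar>y\<bar>) \<le> y" "y \<le> \<tau> (E * \<bar>y\<bar>)"
        using growth[of "- E * \<bar>y\<bar>" 0] growth[of 0 "E * \<bar>y\<bar>"] Epos by (auto simp: \<tau>_def)
      moreover have "continuous_on {- E * \<bar>y\<bar>..E * \<bar>y\<bar>} \<tau>"
        using der by (meson DERIV_isCont continuous_at_imp_continuous_on)
      ultimately show ?thesis
        using IVT'[of \<tau> "- E * \<bar>y\<bar>" y "E * \<bar>y\<bar>"] Epos by (auto simp: abs_mult)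
    qed
    then show ?thesis by (auto simp: surj_def) metis
  qed
  define \<zeta> where "\<zeta> = inv \<tau>"
  have \<tau>\<zeta>: "\<tau> (\<zeta> t) = t" for t unfolding \<zeta>_def using \<open>surj \<tau>\<close> by (rule surj_f_inv_f)
  have \<zeta>\<tau>: "\<zeta> (\<tau> s) = s" for s unfolding \<zeta>_def using inj by (rule inv_f_f)
  have lip: "dist (\<zeta> x) (\<zeta> y) \<le> E * dist x y" for x y
    using expand[of "\<zeta> x" "\<zeta> y"] by (simp add: \<tau>\<zeta> dist_real_def)
  have "isCont \<zeta> t" for t
  proof -
    have "continuous_on UNIV \<zeta>"
      by (rule lipschitz_on_continuous_on[of E]) (auto intro!: lipschitz_onI lip simp: less_imp_le[OF Epos])
    then show ?thesis by (simp add: continuous_on_eq_continuous_at)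
  qed
  then have "(\<zeta> has_real_derivative inverse (1 / F (\<zeta> t))) (at t)" for t
    using Fpos[of "\<zeta> t"] by (intro DERIV_inverse_function[OF der _ _ _ \<tau>\<zeta>, of t "t - 1" "t + 1"]) auto
  moreover have "\<tau> 0 = 0" by (simp add: \<tau>_def)
  ultimately show thesis
    using that[of \<zeta> \<tau>] der \<zeta>\<tau> by (metis inverse_divide div_by_1)
qed

section \<open>Fields perturbed along one ray\<close>

lemma sum_at_most_one_nonzero_bound:
  fixes h :: "'a \<Rightarrow> real"
  assumes "\<And>k l. k \<in> S \<Longrightarrow> l \<in> S \<Longrightarrow> k \<noteq> l \<Longrightarrow> h k = 0 \<or> h l = 0"
    and "\<And>k. k \<in> S \<Longrightarrow> \<bar>h k\<bar> \<le> C" and "C \<ge> 0"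
  shows "\<bar>\<Sum>k\<in>S. h k\<bar> \<le> C"
proof (cases "finite S \<and> (\<exists>k\<in>S. h k \<noteq> 0)")
  case True
  then obtain k where k: "k \<in> S" "h k \<noteq> 0" by blast
  have "(\<Sum>k\<in>S. h k) = h k + (\<Sum>l\<in>S - {k}. h l)" using True k by (simp add: sum.remove)
  also have "(\<Sum>l\<in>S - {k}. h l) = 0" using assms(1) k by (intro sum.neutral) blast
  finally show ?thesis using assms(2) k by simp
next
  case False
  then have "(\<Sum>k\<in>S. h k) = 0" by (cases "finite S") (auto intro: sum.neutral)
  with assms(3) show ?thesis by simp
qed

text \<open>Equally spaced positions from \<open>R / 2\<close> on; starting at the middle keeps a
  distance from \<eta>, where the rays run together.\<close>

definition ray_pos :: "real \<Rightarrow> nat \<Rightarrow> nat \<Rightarrow> real" where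
  "ray_pos R K k = R * (real K + real k) / (2 * real K)"

lemma ray_pos_separated:
  assumes "k \<noteq> l" "R > 0" "K \<ge> 1"
  shows "R / (2 * real K) \<le> \<bar>ray_pos R K k - ray_pos R K l\<bar>"
proof -
  have "ray_pos R K k - ray_pos R K l = R / (2 * real K) * (real k - real l)"
    by (simp add: ray_pos_def add_divide_distrib diff_divide_distrib algebra_simps)
  moreover have "1 \<le> \<bar>real k - real l\<bar>" using assms(1) by linarith
  ultimately show ?thesis
    using assms(2,3) mult_left_mono[of 1 "\<bar>real k - real l\<bar>" "R / (2 * real K)"] by (simp add: abs_mult)
qed

text \<open>\<delta> is the base speed, \<gamma> scales the perturbation, and
  \<open>R\<^sub>0\<close> is the half-side of a cube around \<eta>. The cut-off field and the
  perturbation may each use half of the derivative bound \<open>D\<close>. The condition \<gamma> at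
  most \<delta> caps the speed at twice \<delta>, and the condition on \<open>2 * R\<close> keeps
  the corresponding stretch of ray on the plateau. As \<open>v $ i\<^sub>0 = 1\<close>, coordinate
  \<open>i\<^sub>0\<close> measures position along the ray.\<close>

locale ray_perturbation = bump_family r \<Theta> \<kappa> B for r \<Theta> \<kappa> B +
  fixes \<eta> v :: "real^'d::finite" and i\<^sub>0 :: 'd and D \<delta> \<gamma> R R\<^sub>0 :: real and K :: nat
  assumes v01: "\<And>j. 0 \<le> v $ j" "\<And>j. v $ j \<le> 1" and v_i0: "v $ i\<^sub>0 = 1"
    and R0: "0 < R\<^sub>0" "R\<^sub>0 \<le> 1"
    and delta: "0 < \<delta>" "\<delta> * B ^ CARD('d) \<le> D / 2 * R\<^sub>0 ^ r"
    and gamma: "0 < \<gamma>" "\<gamma> \<le> \<delta>" "\<gamma> * B ^ CARD('d) \<le> D / 2"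
    and R: "0 < R" "2 * R \<le> \<kappa> * R\<^sub>0"
    and K: "1 \<le> K"
begin

text \<open>A quarter of the spacing of the nodes, so cells of half-length 2\<rho> around the nodes
  tile the outer half of the segment up to a shift.\<close>

definition \<rho> :: real where "\<rho> = R / (8 * real K)"

definition node :: "nat \<Rightarrow> real^'d" where "node k = \<eta> + ray_pos R K k *\<^sub>R v"

definition speed :: "nat set \<Rightarrow> 'd list \<Rightarrow> real^'d \<Rightarrow> real" where
  "speed S ks x = \<delta> * bump R\<^sub>0 \<eta> ks x + (\<Sum>k\<in>S. \<gamma> * \<rho> ^ r * bump \<rho> (node k) ks x)"

definition velocity :: "nat set \<Rightarrow> real^'d \<Rightarrow> real^'d" where
  "velocity S x = speed S [] x *\<^sub>R v"

text \<open>The cut-off is replaced by its plateau value, so the speed is at least \<delta> for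
  every real \<open>s\<close> and the scalar theory applies globally. It agrees with the true field
  where the solution lives.\<close>

definition ray_speed :: "nat set \<Rightarrow> real \<Rightarrow> real" where
  "ray_speed S s = \<delta> + (\<Sum>k\<in>S. \<gamma> * \<rho> ^ r * bump \<rho> (node k) [] (\<eta> + s *\<^sub>R v))"

lemma rho: "0 < \<rho>" "\<rho> \<le> 1" "8 * \<rho> \<le> R" "4 * \<rho> = R / (2 * real K)"
proof -
  show "0 < \<rho>" using R K by (simp add: \<rho>_def)
  show "4 * \<rho> = R / (2 * real K)" by (simp add: \<rho>_def)
  show 8: "8 * \<rho> \<le> R"
    using R K mult_left_mono[of 1 "real K" R] by (simp add: \<rho>_def field_simps)
  have "\<kappa> * R\<^sub>0 \<le> 1 * 1" using R0 kappa_less_one by (intro mult_mono) auto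
  with 8 R show "\<rho> \<le> 1" by linarith
qed

lemma rho_power: "0 < \<gamma> * \<rho> ^ r" "\<gamma> * \<rho> ^ r \<le> \<delta>"
proof -
  show "0 < \<gamma> * \<rho> ^ r" using rho gamma by simp
  have "\<gamma> * \<rho> ^ r \<le> \<gamma> * 1" using rho gamma by (intro mult_left_mono power_le_one) auto
  also have "\<dots> \<le> \<delta>" using gamma by simp
  finally show "\<gamma> * \<rho> ^ r \<le> \<delta>" .
qed

lemma bump_node_disjoint:
  assumes "k \<noteq> l"
  shows "bump \<rho> (node k) ks x = 0 \<or> bump \<rho> (node l) ks x = 0"
proof (rule ccontr)
  assume "\<not> ?thesis"
  then have "\<bar>x $ i\<^sub>0 - node k $ i\<^sub>0\<bar> < \<rho>" "\<bar>x $ i\<^sub>0 - node l $ i\<^sub>0\<bar> < \<rho>"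
    using bump_vanish[OF rho(1), where j = i\<^sub>0] by (meson not_less)+
  moreover have "4 * \<rho> \<le> \<bar>ray_pos R K k - ray_pos R K l\<bar>"
    using ray_pos_separated[OF assms R(1) K] rho(4) by simp
  ultimately show False using rho(1) by (simp add: node_def v_i0)
qed

text \<open>The supports are disjoint, so at most one term is nonzero and the bound does not depend
  on the number of bumps.\<close>

lemma abs_perturbation_le:
  assumes "\<And>k. \<bar>bump \<rho> (node k) ks x\<bar> * \<rho> ^ r \<le> C"
  shows "\<bar>\<Sum>k\<in>S. \<gamma> * \<rho> ^ r * bump \<rho> (node k) ks x\<bar> \<le> \<gamma> * C"
proof (rule sum_at_most_one_nonzero_bound)
  show "\<gamma> * \<rho> ^ r * bump \<rho> (node k) ks x = 0 \<or> \<gamma> * \<rho> ^ r * bump \<rho> (node l) ks x = 0"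
    if "k \<noteq> l" for k l using bump_node_disjoint[OF that] by auto
  show "\<bar>\<gamma> * \<rho> ^ r * bump \<rho> (node k) ks x\<bar> \<le> \<gamma> * C" for k
    using mult_left_mono[OF assms, of \<gamma> k] gamma rho by (simp add: abs_mult mult_ac)
  have "0 \<le> C" by (rule order_trans[OF _ assms[of 0]]) (use rho in auto)
  then show "0 \<le> \<gamma> * C" using gamma by simp
qed

lemma partials_speed: "partials r (speed S)"
proof -
  have "partials r (\<lambda>ks x. \<delta> * bump R\<^sub>0 \<eta> ks x + (\<Sum>k\<in>S. \<gamma> * \<rho> ^ r * bump \<rho> (node k) ks x))"
    by (intro partials_add partials_cmult partials_sum partials_bump R0 rho)
  then show ?thesis by (simp add: speed_def[abs_def])
qed

lemma abs_speed_le: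
  assumes "length ks \<le> r"
  shows "\<bar>speed S ks x\<bar> \<le> D"
proof -
  have "\<delta> * (\<bar>bump R\<^sub>0 \<eta> ks x\<bar> * R\<^sub>0 ^ r) \<le> \<delta> * B ^ CARD('d)"
    using abs_bump_le[OF R0 assms] delta by (intro mult_left_mono) auto
  also have "\<dots> \<le> D / 2 * R\<^sub>0 ^ r" by (rule delta)
  finally have "(\<delta> * \<bar>bump R\<^sub>0 \<eta> ks x\<bar>) * R\<^sub>0 ^ r \<le> D / 2 * R\<^sub>0 ^ r" by (simp add: mult.assoc)
  then have "\<delta> * \<bar>bump R\<^sub>0 \<eta> ks x\<bar> \<le> D / 2"
    using R0 by (meson mult_right_le_imp_le zero_less_power)
  moreover have "\<bar>\<Sum>k\<in>S. \<gamma> * \<rho> ^ r * bump \<rho> (node k) ks x\<bar> \<le> \<gamma> * B ^ CARD('d)"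
    by (intro abs_perturbation_le abs_bump_le rho assms)
  ultimately show ?thesis
    using gamma(3) delta(1) abs_triangle_ineq[of "\<delta> * bump R\<^sub>0 \<eta> ks x"
        "\<Sum>k\<in>S. \<gamma> * \<rho> ^ r * bump \<rho> (node k) ks x"]
    by (simp add: speed_def abs_mult)
qed

lemma iter_partial_velocity:
  assumes "length ks \<le> r"
  shows "iter_partial ks (\<lambda>x. velocity S x $ j) = (\<lambda>x. v $ j * speed S ks x)"
  using partials_iter_partial[OF partials_cmult[OF partials_speed, of "v $ j" S] assms]
  by (simp add: velocity_def mult.commute)

lemma ray_pos_bounds:
  assumes "k < K"
  shows "4 * \<rho> \<le> ray_pos R K k" "ray_pos R K k \<le> R - 4 * \<rho>"
proof -
  have "R * 1 \<le> R * (real K + real k)" "R * (real K + real k) \<le> R * (2 * real K - 1)"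
    using assms R by (intro mult_left_mono; simp)+
  then have "R * 1 / (2 * real K) \<le> ray_pos R K k" "ray_pos R K k \<le> R * (2 * real K - 1) / (2 * real K)"
    unfolding ray_pos_def by (intro divide_right_mono; simp)+
  moreover have "R * (2 * real K - 1) / (2 * real K) = R - R / (2 * real K)"
    using K by (simp add: field_simps)
  ultimately show "4 * \<rho> \<le> ray_pos R K k" "ray_pos R K k \<le> R - 4 * \<rho>"
    by (simp_all add: rho(4))
qed

lemma velocity_F_class:
  assumes M: "\<And>y. (\<And>j. \<bar>y $ j - \<eta> $ j\<bar> < R\<^sub>0) \<Longrightarrow> y \<in> M"
    and S: "S \<subseteq> {..<K}"
  shows "velocity S \<in> F_class r D M"
proof -
  have "C_class r (\<lambda>x. velocity S x $ j)" for j
    using partials_C_class[OF partials_cmult[OF partials_speed, of "v $ j" S]]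
    by (simp add: velocity_def mult.commute)
  moreover have "\<bar>iter_partial ks (\<lambda>x. velocity S x $ j) y\<bar> \<le> D" if "length ks \<le> r" for ks j y
    using mult_mono[OF v01(2)[of j] abs_speed_le[OF that, of S y]] v01(1)[of j]
    by (simp add: iter_partial_velocity[OF that] abs_mult)
  moreover have "velocity S y = 0" if "y \<notin> M" for y
  proof -
    have "\<exists>j. \<not> \<bar>y $ j - \<eta> $ j\<bar> < R\<^sub>0" using M[of y] that by blast
    then obtain j where j: "\<bar>y $ j - \<eta> $ j\<bar> \<ge> R\<^sub>0" by (auto simp: not_less)
    \<comment> \<open>Coordinate \<open>j\<close> of \<open>y\<close> is at least
      \<open>R\<^sub>0\<close> away from \<eta>, while node \<open>k\<close> is at most
      \<open>R - 4 * \<rho>\<close> away and \<open>2 * R\<close> is below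
      \<open>R\<^sub>0\<close>.\<close>
    have "bump \<rho> (node k) [] y = 0" if "k \<in> S" for k
    proof (rule bump_vanish[OF rho(1)])
      have pos: "0 \<le> ray_pos R K k" "ray_pos R K k \<le> R - 4 * \<rho>"
        using ray_pos_bounds[of k] S that rho(1) by auto
      have "\<bar>ray_pos R K k * v $ j\<bar> \<le> (R - 4 * \<rho>) * 1"
        unfolding abs_mult using pos v01[of j] by (intro mult_mono) auto
      moreover have "\<kappa> * R\<^sub>0 \<le> R\<^sub>0" using kappa_less_one R0 by simp
      ultimately show "\<rho> \<le> \<bar>y $ j - node k $ j\<bar>"
        using j R rho(1) by (simp add: node_def)
    qed
    then show ?thesis using bump_vanish[OF R0(1) j] by (simp add: velocity_def speed_def)
  qed
  ultimately show ?thesis by (simp add: F_class_def)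
qed

lemma velocity_on_ray:
  assumes "0 \<le> s" "s \<le> 2 * R"
  shows "velocity S (\<eta> + s *\<^sub>R v) = ray_speed S s *\<^sub>R v"
proof -
  have "\<bar>s * v $ j\<bar> \<le> (\<kappa> * R\<^sub>0) * 1" for j
    unfolding abs_mult using assms R v01[of j] by (intro mult_mono) auto
  then have "bump R\<^sub>0 \<eta> [] (\<eta> + s *\<^sub>R v) = 1"
    by (intro bump_plateau R0) auto
  then show ?thesis by (simp add: velocity_def speed_def ray_speed_def)
qed

lemma ray_speed_bounds:
  assumes "S \<subseteq> {..<K}"
  shows "\<delta> \<le> ray_speed S s" "ray_speed S s \<le> 2 * \<delta>"
    and "k \<in> S \<Longrightarrow> \<bar>s - ray_pos R K k\<bar> \<le> \<kappa> * \<rho> \<Longrightarrow> \<delta> + \<gamma> * \<rho> ^ r \<le> ray_speed S s"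
proof -
  let ?h = "\<lambda>k. \<gamma> * \<rho> ^ r * bump \<rho> (node k) [] (\<eta> + s *\<^sub>R v)"
  have fin: "finite S" using assms finite_subset by blast
  have nn: "0 \<le> ?h k" for k
    by (intro mult_nonneg_nonneg[OF less_imp_le[OF rho_power(1)]] bump_nonneg)
  then show "\<delta> \<le> ray_speed S s" by (simp add: ray_speed_def sum_nonneg)
  have "\<bar>\<Sum>k\<in>S. ?h k\<bar> \<le> \<gamma> * 1"
  proof (rule abs_perturbation_le)
    show "\<bar>bump \<rho> (node k) [] (\<eta> + s *\<^sub>R v)\<bar> * \<rho> ^ r \<le> 1" for k
      using bump_nonneg[of \<rho> "node k" "\<eta> + s *\<^sub>R v"] bump_le_one[of \<rho> "node k" "\<eta> + s *\<^sub>R v"] rho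
      by (intro mult_le_one) (auto intro: power_le_one)
  qed
  then show "ray_speed S s \<le> 2 * \<delta>" using gamma by (simp add: ray_speed_def)
  show "\<delta> + \<gamma> * \<rho> ^ r \<le> ray_speed S s" if k: "k \<in> S" "\<bar>s - ray_pos R K k\<bar> \<le> \<kappa> * \<rho>"
  proof -
    have "\<bar>(\<eta> + s *\<^sub>R v) $ j - node k $ j\<bar> \<le> \<kappa> * \<rho>" for j
    proof -
      have "(\<eta> + s *\<^sub>R v) $ j - node k $ j = (s - ray_pos R K k) * v $ j"
        by (simp add: node_def algebra_simps)
      moreover have "\<bar>(s - ray_pos R K k) * v $ j\<bar> \<le> (\<kappa> * \<rho>) * 1"
        unfolding abs_mult using k v01[of j] by (intro mult_mono) auto
      ultimately show ?thesis by simp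
    qed
    then have "bump \<rho> (node k) [] (\<eta> + s *\<^sub>R v) = 1" by (rule bump_plateau[OF rho(1)])
    then have "\<gamma> * \<rho> ^ r = ?h k" by simp
    also have "?h k \<le> (\<Sum>k\<in>S. ?h k)" using fin k nn by (intro member_le_sum) auto
    finally show ?thesis by (simp add: ray_speed_def)
  qed
qed

lemma continuous_ray_speed: "continuous_on UNIV (ray_speed S)"
proof -
  have "continuous_on UNIV (bump \<rho> c [])" for c :: "real^'d"
    using partials_bump[OF rho(1), of c] unfolding partials_def by blast
  then have "continuous_on UNIV (\<lambda>s. bump \<rho> c [] (\<eta> + s *\<^sub>R v))" for c
    by (rule continuous_on_compose2) (auto intro!: continuous_intros)
  then show ?thesis unfolding ray_speed_def by (intro continuous_intros)
qed

lemma solves_ivp_velocity: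
  assumes \<zeta>: "\<And>t. (\<zeta> has_real_derivative ray_speed S (\<zeta> t)) (at t)" "\<zeta> 0 = 0"
    and S: "S \<subseteq> {..<K}" and ab: "R = \<delta> * (b - a)"
  shows "solves_ivp a b \<eta> (velocity S) (\<lambda>t. \<eta> + \<zeta> (t - a) *\<^sub>R v)"
  unfolding solves_ivp_def
proof (intro conjI ballI)
  show "\<eta> + \<zeta> (a - a) *\<^sub>R v = \<eta>" using \<zeta>(2) by simp
  fix t assume t: "t \<in> {a..b}"
  \<comment> \<open>With speed at most twice \<delta> during time \<open>b - a\<close>, the position
    stays below \<open>2 * R\<close>, so the field still equals \<open>ray_speed\<close> times
    \<open>v\<close>.\<close>
  have "0 \<le> \<zeta> (t - a) \<and> \<zeta> (t - a) \<le> 2 * R"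
  proof (cases "t = a")
    case True
    then show ?thesis using \<zeta>(2) R by simp
  next
    case False
    with t obtain x where "\<zeta> (t - a) - \<zeta> 0 = (t - a - 0) * ray_speed S (\<zeta> x)"
      using MVT2[of 0 "t - a" \<zeta> "\<lambda>t. ray_speed S (\<zeta> t)"] \<zeta>(1) by auto
    moreover have "(t - a) * ray_speed S (\<zeta> x) \<le> (b - a) * (2 * \<delta>)"
      using t ray_speed_bounds(1,2)[OF S, of "\<zeta> x"] delta(1) by (intro mult_mono) auto
    moreover have "0 \<le> (t - a) * ray_speed S (\<zeta> x)"
      using t ray_speed_bounds(1)[OF S, of "\<zeta> x"] delta(1) by (intro mult_nonneg_nonneg) auto
    ultimately show ?thesis using \<zeta>(2) ab by (simp add: algebra_simps)
  qed
  then have eq: "velocity S (\<eta> + \<zeta> (t - a) *\<^sub>R v) = ray_speed S (\<zeta> (t - a)) *\<^sub>R v"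
    by (intro velocity_on_ray) auto
  have "((\<lambda>t. \<zeta> (t - a)) has_real_derivative ray_speed S (\<zeta> (t - a)) * 1) (at t within {a..b})"
    by (rule DERIV_chain2[OF \<zeta>(1)]) (auto intro!: derivative_eq_intros)
  then have "((\<lambda>t. \<zeta> (t - a)) has_vector_derivative ray_speed S (\<zeta> (t - a))) (at t within {a..b})"
    by (simp add: has_real_derivative_iff_has_vector_derivative)
  from has_vector_derivative_add[OF has_vector_derivative_const[of \<eta>]
      bounded_linear.has_vector_derivative[OF bounded_linear_scaleR_left[of v] this]]
  show "((\<lambda>t. \<eta> + \<zeta> (t - a) *\<^sub>R v) has_vector_derivative velocity S (\<eta> + \<zeta> (t - a) *\<^sub>R v)) (at t within {a..b})"
    unfolding eq by simp
qed

section \<open>Travel times and the resulting error\<close>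

text \<open>Comparing the times needed to reach position \<open>R\<close>, i.e. the integrals of \<open>1 / ray_speed\<close>, avoids
  estimating the perturbed solution itself.\<close>

lemma travel_time_gain:
  assumes \<tau>: "\<And>s. (\<tau> has_real_derivative 1 / ray_speed S s) (at s)" "\<tau> 0 = 0"
    and S: "S \<subseteq> {..<K}"
  shows "real (card S) * (\<kappa> * \<gamma> * \<rho> ^ Suc r / \<delta>) \<le> R - \<delta> * \<tau> R"
proof -
  \<comment> \<open>The time saved on the way to \<open>s\<close>, compared with constant speed
    \<delta>.\<close>
  define h where "h s = s / \<delta> - \<tau> s" for s
  \<comment> \<open>A lower bound for the time saved per unit length on a plateau: 1/\<delta> minus
    the reciprocal of the raised speed, with the raised speed estimated by twice \<delta> in the
    denominator.\<close>
  define c where "c = \<gamma> * \<rho> ^ r / (2 * \<delta>\<^sup>2)"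
  have der: "(h has_real_derivative 1 / \<delta> - 1 / ray_speed S s) (at s)" for s
    unfolding h_def using delta(1) by (auto intro!: derivative_eq_intros \<tau>)
  have mono: "h s \<le> h s'" if "s \<le> s'" for s s'
  proof (rule DERIV_nonneg_imp_nondecreasing[OF that])
    fix x
    have "1 / ray_speed S x \<le> 1 / \<delta>"
      using ray_speed_bounds(1)[OF S, of x] delta(1) by (intro divide_left_mono) auto
    with der[of x] show "\<exists>y. (h has_real_derivative y) (at x) \<and> 0 \<le> y" by force
  qed
  \<comment> \<open>Cell boundaries half-way between nodes, so that the gains telescope;
    \<open>u 0\<close> and \<open>u K\<close> stay inside [0, R].\<close>
  define u where "u k = R / 2 + R * real k / (2 * real K) - 2 * \<rho>" for k
  have pos: "u k = ray_pos R K k - 2 * \<rho>" "u (Suc k) = ray_pos R K k + 2 * \<rho>" for k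
    using rho(4) K by (simp_all add: u_def ray_pos_def field_simps)
  \<comment> \<open>Only the plateau, of length \<open>2 * \<kappa> * \<rho>\<close>, is counted; on
    the rest of a cell monotonicity of \<open>h\<close> suffices.\<close>
  have step: "(if k \<in> S then 2 * \<kappa> * \<rho> * c else 0) \<le> h (u (Suc k)) - h (u k)" for k
  proof (cases "k \<in> S")
    case False
    then show ?thesis using mono[of "u k" "u (Suc k)"] rho(1) by (simp add: pos(1)[of k] pos(2)[of k])
  next
    case True
    let ?p = "ray_pos R K k"
    have kr: "0 < \<kappa> * \<rho>" "\<kappa> * \<rho> \<le> \<rho>" using kappa_pos kappa_less_one rho(1) by auto
    then obtain x where x: "?p - \<kappa> * \<rho> < x" "x < ?p + \<kappa> * \<rho>"
      and hx: "h (?p + \<kappa> * \<rho>) - h (?p - \<kappa> * \<rho>) = 2 * (\<kappa> * \<rho>) * (1 / \<delta> - 1 / ray_speed S x)"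
      using MVT2[of "?p - \<kappa> * \<rho>" "?p + \<kappa> * \<rho>" h "\<lambda>s. 1 / \<delta> - 1 / ray_speed S s"] der by auto
    have "\<delta> + \<gamma> * \<rho> ^ r \<le> ray_speed S x" using x by (intro ray_speed_bounds(3)[OF S True]) auto
    then have "1 / ray_speed S x \<le> 1 / (\<delta> + \<gamma> * \<rho> ^ r)"
      using delta(1) rho_power by (intro divide_left_mono) auto
    moreover have "c \<le> 1 / \<delta> - 1 / (\<delta> + \<gamma> * \<rho> ^ r)"
    proof -
      have "\<delta> * (\<delta> + \<gamma> * \<rho> ^ r) \<le> \<delta> * (2 * \<delta>)" using delta rho_power by (intro mult_left_mono) auto
      then have "c \<le> \<gamma> * \<rho> ^ r / (\<delta> * (\<delta> + \<gamma> * \<rho> ^ r))"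
        unfolding c_def using delta rho_power
        by (intro divide_left_mono) (auto simp: power2_eq_square)
      also have "\<dots> = 1 / \<delta> - 1 / (\<delta> + \<gamma> * \<rho> ^ r)" using delta rho_power by (simp add: field_simps)
      finally show ?thesis .
    qed
    ultimately have "2 * (\<kappa> * \<rho>) * c \<le> h (?p + \<kappa> * \<rho>) - h (?p - \<kappa> * \<rho>)"
      unfolding hx using kr by (intro mult_left_mono) auto
    also have "\<dots> \<le> h (u (Suc k)) - h (u k)"
      using kr rho(1) by (intro diff_mono mono) (auto simp: pos(1)[of k] pos(2)[of k])
    finally show ?thesis using True by (simp add: mult.assoc)
  qed
  have "real (card S) * (2 * \<kappa> * \<rho> * c) = (\<Sum>k<K. if k \<in> S then 2 * \<kappa> * \<rho> * c else 0)"
    using S by (simp add: sum.If_cases Int_absorb1)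
  also have "\<dots> \<le> (\<Sum>k<K. h (u (Suc k)) - h (u k))" by (intro sum_mono step)
  also have "\<dots> = h (u K) - h (u 0)" by (rule sum_lessThan_telescope)
  also have "\<dots> \<le> h R - h 0" using rho K R by (intro diff_mono mono) (auto simp: u_def)
  finally have "\<delta> * (real (card S) * (2 * \<kappa> * \<rho> * c)) \<le> \<delta> * (R / \<delta> - \<tau> R)"
    using delta \<tau>(2) by (intro mult_left_mono) (auto simp: h_def)
  moreover have "\<delta> * (R / \<delta> - \<tau> R) = R - \<delta> * \<tau> R" using delta by (simp add: field_simps)
  moreover have "\<delta> * (real (card S) * (2 * \<kappa> * \<rho> * c)) = real (card S) * (\<kappa> * \<gamma> * \<rho> ^ Suc r / \<delta>)"
    using delta by (simp add: c_def power2_eq_square)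
  ultimately show ?thesis by simp
qed

text \<open>The solutions are compared at time \<open>a + \<tau> R\<close>: the perturbed one has
  just reached position \<open>R\<close>, the unperturbed one only
  \<open>\<delta> * \<tau> R\<close>. Since no time is lost, this moment lies in [a, b].\<close>

lemma fooling_lower_bound:
  assumes M: "\<And>y. (\<And>j. \<bar>y $ j - \<eta> $ j\<bar> < R\<^sub>0) \<Longrightarrow> y \<in> M"
    and S: "S \<subseteq> {..<K}" "K \<le> 2 * card S" and ab: "R = \<delta> * (b - a)" and r: "r \<ge> 1"
    and info: "info N (velocity S) = info N (velocity {})"
    and err: "worst_error a b \<eta> (F_class r D M) N \<Phi> \<le> ereal \<epsilon>"
  shows "\<kappa> * \<gamma> * R * \<rho> ^ r / (16 * \<delta>) \<le> 2 * \<epsilon>"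
proof -
  obtain \<zeta> \<tau> where \<zeta>: "\<And>t. (\<zeta> has_real_derivative ray_speed S (\<zeta> t)) (at t)" "\<zeta> 0 = 0"
    and \<tau>: "\<And>s. (\<tau> has_real_derivative 1 / ray_speed S s) (at s)" "\<tau> 0 = 0"
    and inv: "\<And>s. \<zeta> (\<tau> s) = s"
    using autonomous_scalar_solution[OF continuous_ray_speed ray_speed_bounds(1,2)[OF S(1)] delta(1)]
    by metis
  have gain: "real (card S) * (\<kappa> * \<gamma> * \<rho> ^ Suc r / \<delta>) \<le> R - \<delta> * \<tau> R"
    by (rule travel_time_gain[OF \<tau> S(1)])
  have gain_nonneg: "0 \<le> real (card S) * (\<kappa> * \<gamma> * \<rho> ^ Suc r / \<delta>)"
    using kappa_pos gamma rho delta by simp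
  obtain x where "\<tau> R - \<tau> 0 = (R - 0) * (1 / ray_speed S x)"
    using MVT2[of 0 R \<tau> "\<lambda>s. 1 / ray_speed S s"] \<tau>(1) R by auto
  then have "0 \<le> \<tau> R" using \<tau>(2) R ray_speed_bounds(1)[OF S(1), of x] delta(1) by simp
  moreover have "\<delta> * \<tau> R \<le> \<delta> * (b - a)" using gain gain_nonneg ab by linarith
  then have "\<tau> R \<le> b - a" using delta(1) by simp
  ultimately have t: "a + \<tau> R \<in> {a..b}" by simp
  have z: "ivp_solution a b \<eta> (velocity S) (a + \<tau> R) = \<eta> + R *\<^sub>R v"
    using ivp_solution_eq[OF velocity_F_class[OF M S(1)] r solves_ivp_velocity[OF \<zeta> S(1) ab] t] inv
    by simp
  have "((\<lambda>t. \<delta> * t) has_real_derivative ray_speed {} (\<delta> * t)) (at t)" for t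
    by (auto intro!: derivative_eq_intros simp: ray_speed_def)
  from ivp_solution_eq[OF velocity_F_class[OF M] r solves_ivp_velocity[OF this _ _ ab] t]
  have z0: "ivp_solution a b \<eta> (velocity {}) (a + \<tau> R) = \<eta> + (\<delta> * \<tau> R) *\<^sub>R v"
    by simp
  have "R - \<delta> * \<tau> R \<le> 2 * \<epsilon>"
    using worst_error_fooling[OF velocity_F_class[OF M S(1)] velocity_F_class[OF M] info err t, of i\<^sub>0]
    by (simp add: z z0 v_i0)
  \<comment> \<open>The number of cubes absorbs one power of \<rho>, since
    \<open>real K * \<rho> = R / 8\<close>.\<close>
  moreover have "\<kappa> * \<gamma> * R * \<rho> ^ r / (16 * \<delta>) = (real K / 2) * (\<kappa> * \<gamma> * \<rho> ^ Suc r / \<delta>)"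
    using K delta by (simp add: \<rho>_def)
  moreover have "(real K / 2) * (\<kappa> * \<gamma> * \<rho> ^ Suc r / \<delta>) \<le> real (card S) * (\<kappa> * \<gamma> * \<rho> ^ Suc r / \<delta>)"
    using S(2) kappa_pos gamma rho delta by (intro mult_right_mono) auto
  ultimately show ?thesis using gain by linarith
qed

lemma velocity_same_value:
  assumes "length ks \<le> r" "\<And>k. k \<in> S \<Longrightarrow> \<exists>j. \<rho> \<le> \<bar>y $ j - node k $ j\<bar>"
  shows "iter_partial ks (\<lambda>x. velocity S x $ i) y = iter_partial ks (\<lambda>x. velocity {} x $ i) y"
proof -
  have "bump \<rho> (node k) ks y = 0" if "k \<in> S" for k
    using assms(2)[OF that] bump_vanish[OF rho(1)] by blast
  then show ?thesis by (simp add: iter_partial_velocity[OF assms(1)] speed_def)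
qed

end

section \<open>Choosing a ray that the information misses\<close>

text \<open>Double counting: a functional hits at most one pair (m, k), so there are at most
  \<open>length N\<close> hit pairs. If more than half of the \<open>K\<close> cells were hit for
  every \<open>m\<close>, there would be more.\<close>

lemma ex_few_hits:
  fixes H :: "'l \<Rightarrow> 'm \<Rightarrow> nat \<Rightarrow> bool"
  assumes V: "finite V" "V \<noteq> {}" and N: "2 * length N \<le> card V * K"
    and once: "\<And>L m k m' k'. H L m k \<Longrightarrow> H L m' k' \<Longrightarrow> m \<in> V \<Longrightarrow> m' \<in> V \<Longrightarrow> m = m' \<and> k = k'"
  shows "\<exists>m\<in>V. K \<le> 2 * card {k\<in>{..<K}. \<forall>L\<in>set N. \<not> H L m k}"
proof (rule ccontr)
  define hit where "hit m = {k\<in>{..<K}. \<exists>L\<in>set N. H L m k}" for m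
  assume none: "\<not> ?thesis"
  then have few: "2 * card {k\<in>{..<K}. \<forall>L\<in>set N. \<not> H L m k} < K" if "m \<in> V" for m
  proof -
    have "\<not> K \<le> 2 * card {k\<in>{..<K}. \<forall>L\<in>set N. \<not> H L m k}" using none that by blast
    then show ?thesis by simp
  qed
  have "K < 2 * card (hit m)" if "m \<in> V" for m
  proof -
    have "card {..<K} = card (hit m \<union> {k\<in>{..<K}. \<forall>L\<in>set N. \<not> H L m k})"
      by (rule arg_cong[of _ _ card]) (auto simp: hit_def)
    also have "\<dots> \<le> card (hit m) + card {k\<in>{..<K}. \<forall>L\<in>set N. \<not> H L m k}" by (rule card_Un_le)
    finally show ?thesis using few[OF that] by simp
  qed
  then have lt: "(\<Sum>m\<in>V. K) < (\<Sum>m\<in>V. 2 * card (hit m))" using V by (intro sum_strict_mono) auto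
  have "card V * K < 2 * card (SIGMA m:V. hit m)"
  proof -
    have "card (SIGMA m:V. hit m) = (\<Sum>m\<in>V. card (hit m))"
      by (rule card_SigmaI) (use V in \<open>auto simp: hit_def\<close>)
    with lt show ?thesis by (simp add: sum_distrib_left)
  qed
  moreover have "card (SIGMA m:V. hit m) \<le> length N"
  proof -
    \<comment> \<open>The only pair that \<open>L\<close> can hit, if there is one; the image of
      \<open>set N\<close> then covers all hit pairs.\<close>
    define f where "f L = (SOME q. fst q \<in> V \<and> H L (fst q) (snd q))" for L
    have "(SIGMA m:V. hit m) \<subseteq> f ` set N"
    proof
      fix q assume "q \<in> (SIGMA m:V. hit m)"
      then obtain m k L where q: "q = (m, k)" "m \<in> V" "L \<in> set N" "H L m k" by (auto simp: hit_def)
      then have "\<exists>q. fst q \<in> V \<and> H L (fst q) (snd q)" by (intro exI[of _ "(m, k)"]) simp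
      then have "fst (f L) \<in> V \<and> H L (fst (f L)) (snd (f L))" unfolding f_def by (rule someI_ex)
      with once[of L m k "fst (f L)" "snd (f L)"] q have "q = f L" by (simp add: prod_eq_iff)
      then show "q \<in> f ` set N" using \<open>L \<in> set N\<close> by (rule image_eqI)
    qed
    then have "card (SIGMA m:V. hit m) \<le> card (set N)" by (rule surj_card_le[OF finite_set])
    then show ?thesis using card_length[of N] by simp
  qed
  ultimately show False using N by simp
qed

definition ray_dir :: "nat \<Rightarrow> ('d \<Rightarrow> nat) \<Rightarrow> real^'d::finite" where
  "ray_dir K m = (\<chi> j. real (m j) / real K)"

text \<open>Fixing \<open>m i\<^sub>0 = K\<close> makes coordinate \<open>i\<^sub>0\<close> the parameter along every ray.\<close>

definition ray_dirs :: "'d::finite \<Rightarrow> nat \<Rightarrow> ('d \<Rightarrow> nat) set" where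
  "ray_dirs i\<^sub>0 K = Pi\<^sub>E UNIV (\<lambda>j. if j = i\<^sub>0 then {K} else {..<K})"

lemma card_ray_dirs:
  fixes i\<^sub>0 :: "'d::finite"
  shows "card (ray_dirs i\<^sub>0 K) * K = K ^ CARD('d)"
proof -
  have "card (ray_dirs i\<^sub>0 K) = (\<Prod>j\<in>UNIV. card (if j = i\<^sub>0 then {K} else {..<K}))"
    by (simp add: ray_dirs_def card_PiE)
  also have "\<dots> = (\<Prod>j\<in>UNIV - {i\<^sub>0}. K)"
    by (subst prod.remove[of _ i\<^sub>0]) (auto intro!: prod.cong)
  also have "\<dots> = K ^ (CARD('d) - 1)" by (simp add: card_Diff_singleton)
  finally show ?thesis by (simp only: power_minus_mult[OF zero_less_card_finite])
qed

text \<open>Nodes of two cubes with a common point differ by less than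
  \<open>R / (4 * real K)\<close> in each coordinate. Coordinate \<open>i\<^sub>0\<close> then
  forces \<open>k = k'\<close>. For equal \<open>k\<close>, different slopes separate coordinate
  \<open>j\<close> by at least \<open>R / (2 * real K)\<close>, because \<open>ray_pos\<close> is at
  least \<open>R / 2\<close>.\<close>

lemma ray_nodes_separated:
  fixes \<eta> y :: "real^'d::finite"
  assumes "m \<in> ray_dirs i\<^sub>0 K" "m' \<in> ray_dirs i\<^sub>0 K" "R > 0" "K \<ge> 1"
    and 1: "\<And>j. \<bar>y $ j - (\<eta> + ray_pos R K k *\<^sub>R ray_dir K m) $ j\<bar> < R / (8 * real K)"
    and 2: "\<And>j. \<bar>y $ j - (\<eta> + ray_pos R K k' *\<^sub>R ray_dir K m') $ j\<bar> < R / (8 * real K)"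
  shows "m = m' \<and> k = k'"
proof -
  have close: "\<bar>ray_pos R K k * (real (m j) / real K) - ray_pos R K k' * (real (m' j) / real K)\<bar> < R / (4 * real K)" for j
  proof -
    have "\<bar>(y $ j - (\<eta> $ j + a)) - (y $ j - (\<eta> $ j + b))\<bar> < e + e \<longleftrightarrow> \<bar>a - b\<bar> < e + e" for a b e :: real
      by auto
    moreover have "R / (4 * real K) = R / (8 * real K) + R / (8 * real K)" by simp
    ultimately show ?thesis using 1[of j] 2[of j] unfolding ray_dir_def
      by (simp only: vector_add_component vector_scaleR_component vec_lambda_beta real_scaleR_def)
  qed
  have i0: "m i\<^sub>0 = K" "m' i\<^sub>0 = K" using assms(1,2) by (auto simp: ray_dirs_def PiE_iff split: if_splits)
  have k: "k = k'"
  proof (rule ccontr)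
    assume "k \<noteq> k'"
    from ray_pos_separated[OF this assms(3,4)] close[of i\<^sub>0] show False
      using assms(3,4) by (simp add: i0 field_simps)
  qed
  have "m j = m' j" for j
  proof (rule ccontr)
    assume "m j \<noteq> m' j"
    then have ge: "1 \<le> \<bar>real (m j) - real (m' j)\<bar>" by linarith
    have pos: "R / 2 \<le> ray_pos R K k"
      using assms(3,4) by (simp add: ray_pos_def field_simps)
    have "R / 2 * 1 \<le> ray_pos R K k * \<bar>real (m j) - real (m' j)\<bar>"
      using ge pos assms(3) by (intro mult_mono) auto
    then have "R / 2 / real K \<le> ray_pos R K k * \<bar>real (m j) - real (m' j)\<bar> / real K"
      by (intro divide_right_mono) auto
    also have "\<dots> = \<bar>ray_pos R K k * (real (m j) / real K) - ray_pos R K k * (real (m' j) / real K)\<bar>"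
    proof -
      have "ray_pos R K k * (real (m j) / real K) - ray_pos R K k * (real (m' j) / real K)
          = ray_pos R K k * (real (m j) - real (m' j)) / real K"
        by (simp add: right_diff_distrib diff_divide_distrib)
      then show ?thesis using pos assms(3) by (simp add: abs_mult)
    qed
    also have "\<dots> < R / (4 * real K)" using close[of j] k by simp
    finally show False using assms(3,4) by (simp add: field_simps)
  qed
  with k show ?thesis by auto
qed

text \<open>Here the direction is chosen after \<open>N\<close>, as nonadaptivity permits. The
  perturbation occupies exactly the cells of the chosen ray that contain no sample point.\<close>

lemma worst_error_lower_bound:
  fixes \<eta> :: "real^'d::finite"
  assumes bf: "bump_family r \<Theta> \<kappa> B"
    and R0: "0 < R\<^sub>0" "R\<^sub>0 \<le> 1"
    and delta: "0 < \<delta>" "\<delta> * B ^ CARD('d) \<le> D / 2 * R\<^sub>0 ^ r"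
    and gamma: "0 < \<gamma>" "\<gamma> \<le> \<delta>" "\<gamma> * B ^ CARD('d) \<le> D / 2"
    and R: "0 < R" "2 * R \<le> \<kappa> * R\<^sub>0" and horizon: "R = \<delta> * (b - a)"
    and K: "1 \<le> K" and r: "r \<ge> 1"
    and M: "\<And>y. (\<And>j. \<bar>y $ j - \<eta> $ j\<bar> < R\<^sub>0) \<Longrightarrow> y \<in> M"
    and N: "N \<in> standard_info r" "2 * length N \<le> K ^ CARD('d)"
    and err: "worst_error a b \<eta> (F_class r D M) N \<Phi> \<le> ereal \<epsilon>"
  shows "\<kappa> * \<gamma> * R * (R / (8 * real K)) ^ r / (16 * \<delta>) \<le> 2 * \<epsilon>"
proof -
  obtain i\<^sub>0 :: 'd where True by blast
  have "\<forall>L\<in>set N. \<exists>y ks i. length ks \<le> r \<and> L = (\<lambda>f. iter_partial ks (\<lambda>x. f x $ i) y)"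
    using N(1) by (fastforce simp: standard_info_def standard_functional_def)
  \<comment> \<open>Only the sample point matters, not the order or component of the derivative: a
    bump vanishes together with all its derivatives up to order \<open>r\<close> outside its open
    cube.\<close>
  then obtain pt where pt: "\<And>L. L \<in> set N \<Longrightarrow>
      \<exists>ks i. length ks \<le> r \<and> L = (\<lambda>f. iter_partial ks (\<lambda>x. f x $ i) (pt L))"
    unfolding bchoice_iff by blast
  define H where "H L m k \<longleftrightarrow>
    (\<forall>j. \<bar>pt L $ j - (\<eta> + ray_pos R K k *\<^sub>R ray_dir K m) $ j\<bar> < R / (8 * real K))" for L m k
  have "\<exists>m\<in>ray_dirs i\<^sub>0 K. K \<le> 2 * card {k\<in>{..<K}. \<forall>L\<in>set N. \<not> H L m k}"
  proof (rule ex_few_hits)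
    show "finite (ray_dirs i\<^sub>0 K)" unfolding ray_dirs_def by (intro finite_PiE) auto
    show "ray_dirs i\<^sub>0 K \<noteq> {}" using K by (auto simp: ray_dirs_def PiE_eq_empty_iff dest: equals0D[of _ 0])
    show "2 * length N \<le> card (ray_dirs i\<^sub>0 K) * K" using N(2) by (simp add: card_ray_dirs)
    show "m = m' \<and> k = k'" if "H L m k" "H L m' k'" "m \<in> ray_dirs i\<^sub>0 K" "m' \<in> ray_dirs i\<^sub>0 K" for L m k m' k'
      using that ray_nodes_separated[OF that(3,4) R(1) K] unfolding H_def by blast
  qed
  then obtain m where m: "m \<in> ray_dirs i\<^sub>0 K"
    and card: "K \<le> 2 * card {k\<in>{..<K}. \<forall>L\<in>set N. \<not> H L m k}" by blast
  let ?v = "ray_dir K m" and ?S = "{k\<in>{..<K}. \<forall>L\<in>set N. \<not> H L m k}"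
  have mj: "m j \<in> (if j = i\<^sub>0 then {K} else {..<K})" for j
    using m by (auto simp: ray_dirs_def PiE_iff)
  interpret ray_perturbation r \<Theta> \<kappa> B \<eta> ?v i\<^sub>0 D \<delta> \<gamma> R R\<^sub>0 K
  proof (intro ray_perturbation.intro ray_perturbation_axioms.intro bf R0 delta gamma R K)
    show "0 \<le> ?v $ j" "?v $ j \<le> 1" for j
      using mj[of j] K by (auto simp: ray_dir_def split: if_splits)
    show "?v $ i\<^sub>0 = 1" using mj[of i\<^sub>0] K by (simp add: ray_dir_def)
  qed
  have same: "info N (velocity ?S) = info N (velocity {})"
    unfolding info_def
  proof (rule map_cong[OF refl])
    fix L assume L: "L \<in> set N"
    obtain ks i where ks: "length ks \<le> r" and eq: "L = (\<lambda>f. iter_partial ks (\<lambda>x. f x $ i) (pt L))"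
      using pt[OF L] by blast
    have "\<exists>j. \<rho> \<le> \<bar>pt L $ j - node k $ j\<bar>" if "k \<in> ?S" for k
    proof -
      have "\<not> H L m k" using that L by blast
      then show ?thesis by (auto simp: H_def \<rho>_def node_def not_less)
    qed
    from velocity_same_value[OF ks this] show "L (velocity ?S) = L (velocity {})"
      by (subst (1 2) eq)
  qed
  have "\<kappa> * \<gamma> * R * \<rho> ^ r / (16 * \<delta>) \<le> 2 * \<epsilon>"
  proof (rule fooling_lower_bound[OF _ _ card horizon r same err])
    show "y \<in> M" if "\<And>j. \<bar>y $ j - \<eta> $ j\<bar> < R\<^sub>0" for y using that by (rule M)
  qed auto
  then show ?thesis by (simp only: \<rho>_def)
qed

section \<open>From the error rate to the complexity bound\<close>

text \<open>\<open>K\<close> is taken as large as possible with \<open>c / real K ^ r\<close> still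
  at least 4\<epsilon>. This contradicts \<open>rate\<close> unless \<open>2 * n\<close> exceeds
  \<open>K ^ d\<close>.\<close>

lemma complexity_lower_bound_from_rate:
  fixes d r :: nat
  assumes c: "c > 0" and r: "r \<ge> 1"
    and rate: "\<And>n K. P n \<epsilon> \<Longrightarrow> K \<ge> 1 \<Longrightarrow> 2 * n \<le> K ^ d \<Longrightarrow> c / real K ^ r \<le> 2 * \<epsilon>"
    and eps: "0 < \<epsilon>" "\<epsilon> \<le> c / 4" and P: "P n \<epsilon>"
  shows "(1 / 2) ^ Suc d * (c / 4) powr (real d / real r) * (1 / \<epsilon>) powr (real d / real r) \<le> real n"
proof -
  \<comment> \<open>The real solution of c / X^r = 4\<epsilon>. As \<epsilon> is at most c/4,
    \<open>X\<close> is at least 1 and rounding down loses at most a factor 2. This factor, to the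
    power \<open>d\<close>, and the 2 in \<open>2 * n\<close> make up
    \<open>(1 / 2) ^ Suc d\<close>.\<close>
  define X where "X = (c / (4 * \<epsilon>)) powr (1 / real r)"
  define K where "K = nat \<lfloor>X\<rfloor>"
  have base: "c / (4 * \<epsilon>) \<ge> 1" using eps by simp
  have X1: "X \<ge> 1" unfolding X_def using base by (intro ge_one_powr_ge_zero) auto
  have K: "K \<ge> 1" "real K \<le> X" "X / 2 \<le> real K"
  proof -
    have "1 \<le> \<lfloor>X\<rfloor>" using X1 by simp
    then show "K \<ge> 1" "real K \<le> X" by (simp_all add: K_def le_nat_iff)
    have "real K = real_of_int \<lfloor>X\<rfloor>" using \<open>1 \<le> \<lfloor>X\<rfloor>\<close> by (simp add: K_def)
    then show "X / 2 \<le> real K" using \<open>K \<ge> 1\<close> by linarith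
  qed
  have X_power: "X ^ m = (c / (4 * \<epsilon>)) powr (real m / real r)" for m
  proof -
    have "X ^ m = X powr real m" using X1 by (simp add: powr_realpow)
    then show ?thesis by (simp add: X_def powr_powr)
  qed
  have "X ^ r = c / (4 * \<epsilon>)" using c eps(1) r by (simp add: X_power)
  then have "real K ^ r \<le> c / (4 * \<epsilon>)" using K power_mono[of "real K" X r] by simp
  then have "4 * \<epsilon> \<le> c / real K ^ r" using eps K by (simp add: field_simps)
  then have "\<not> 2 * n \<le> K ^ d" using rate[OF P K(1)] eps by fastforce
  then have "K ^ d \<le> 2 * n" by simp
  then have "real (K ^ d) \<le> real (2 * n)" by (simp only: of_nat_le_iff)
  then have "real K ^ d \<le> 2 * real n" by simp
  moreover have "(X / 2) ^ d \<le> real K ^ d" using K X1 by (intro power_mono) auto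
  moreover have "X ^ d = (c / 4) powr (real d / real r) * (1 / \<epsilon>) powr (real d / real r)"
  proof -
    note X_power[of d]
    also have "c / (4 * \<epsilon>) = (c / 4) * (1 / \<epsilon>)" by simp
    finally show ?thesis using c eps by (simp only: powr_mult)
  qed
  ultimately show ?thesis by (simp add: power_divide mult.assoc)
qed

lemma open_contains_cube:
  fixes \<eta> :: "real^'d::finite"
  assumes "open M" "\<eta> \<in> M"
  obtains e where "0 < e" "e \<le> 1" "\<And>y. (\<And>j. \<bar>y $ j - \<eta> $ j\<bar> < e) \<Longrightarrow> y \<in> M"
proof -
  obtain e where e: "e > 0" "ball \<eta> e \<subseteq> M" using assms openE by blast
  \<comment> \<open>Division by the dimension lets the sum of the coordinate distances bound the
    norm; the cap 1 is what the scaling estimate for bumps requires of the width.\<close>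
  define e' where "e' = min 1 (e / real CARD('d))"
  have "y \<in> M" if "\<And>j. \<bar>y $ j - \<eta> $ j\<bar> < e'" for y
  proof -
    have "norm (y - \<eta>) \<le> (\<Sum>j\<in>UNIV. \<bar>(y - \<eta>) $ j\<bar>)" by (rule norm_le_l1_cart)
    also have "\<dots> < (\<Sum>j\<in>(UNIV::'d set). e')" using that by (intro sum_strict_mono) auto
    also have "\<dots> \<le> e" by (simp add: e'_def min_def field_simps)
    finally show "y \<in> M" using e(2) by (auto simp: dist_norm norm_minus_commute)
  qed
  with e(1) show thesis by (intro that[of e']) (auto simp: e'_def)
qed

theorem theorem1:
  fixes r :: nat and a b D :: real and M :: "(real^'d::finite) set" and \<eta> :: "real^'d"
  assumes "r \<ge> 1" and "a < b" and "D > 0"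
    and "open M" and "M \<noteq> {}" and "\<eta> \<in> M"
  shows "\<exists>C>0. \<exists>\<epsilon>\<^sub>0>0. \<forall>\<epsilon>. 0 < \<epsilon> \<and> \<epsilon> \<le> \<epsilon>\<^sub>0 \<longrightarrow>
    ereal_of_enat (comp_nonad a b \<eta> (F_class r D M) (standard_info r) \<epsilon>)
      \<ge> ereal (C * (1 / \<epsilon>) powr (real CARD('d) / real r))"
proof -
  obtain \<Theta> \<kappa> B where bf: "bump_family r \<Theta> \<kappa> B" using bump_family_exists by blast
  interpret bump_family r \<Theta> \<kappa> B by (rule bf)
  obtain R\<^sub>0 where R0: "0 < R\<^sub>0" "R\<^sub>0 \<le> 1"
    and M: "\<And>y. (\<And>j. \<bar>y $ j - \<eta> $ j\<bar> < R\<^sub>0) \<Longrightarrow> y \<in> M"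
    using open_contains_cube[OF assms(4,6)] by metis
  have Bd: "0 < B ^ CARD('d)" using bound_ge_one by simp
  \<comment> \<open>The first bound keeps the derivatives of the cut-off field below D/2, the second
    gives \<open>2 * R \<le> \<kappa> * R\<^sub>0\<close> for the distance \<open>R\<close>
    travelled at speed \<delta>.\<close>
  define \<delta> where "\<delta> = min (D / 2 * R\<^sub>0 ^ r / B ^ CARD('d)) (\<kappa> * R\<^sub>0 / (2 * (b - a)))"
  define \<gamma> where "\<gamma> = min \<delta> (D / 2 / B ^ CARD('d))"
  define R where "R = \<delta> * (b - a)"
  have \<delta>0: "0 < \<delta>" using R0 Bd assms(2,3) kappa_pos by (simp add: \<delta>_def)
  have \<gamma>0: "0 < \<gamma>" using \<delta>0 Bd assms(3) by (simp add: \<gamma>_def)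
  have \<delta>B: "\<delta> * B ^ CARD('d) \<le> D / 2 * R\<^sub>0 ^ r"
    unfolding pos_le_divide_eq[OF Bd, symmetric] \<delta>_def by simp
  have \<gamma>B: "\<gamma> * B ^ CARD('d) \<le> D / 2"
    unfolding pos_le_divide_eq[OF Bd, symmetric] \<gamma>_def by simp
  have R: "0 < R" using \<delta>0 assms(2) by (simp add: R_def)
  have "\<delta> \<le> \<kappa> * R\<^sub>0 / (2 * (b - a))" by (simp add: \<delta>_def)
  then have R2: "2 * R \<le> \<kappa> * R\<^sub>0" using assms(2) by (simp add: R_def pos_le_divide_eq mult_ac)
  \<comment> \<open>The error bound for \<open>K\<close> cubes per ray with the factor
    \<open>1 / real K ^ r\<close> taken out.\<close>
  define c where "c = \<kappa> * \<gamma> * R * (R / 8) ^ r / (16 * \<delta>)"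
  have c: "c > 0" using kappa_pos \<gamma>0 \<delta>0 R by (simp add: c_def)
  define P where "P n \<epsilon> \<longleftrightarrow> (\<exists>N\<in>standard_info r. length N = n \<and>
    (\<exists>\<Phi>. worst_error a b \<eta> (F_class r D M) N \<Phi> \<le> ereal \<epsilon>))" for n \<epsilon>
  have rate: "c / real K ^ r \<le> 2 * \<epsilon>" if "P n \<epsilon>" "K \<ge> 1" "2 * n \<le> K ^ CARD('d)" for n K \<epsilon>
  proof -
    obtain N \<Phi> where N: "N \<in> standard_info r" "length N = n"
      and err: "worst_error a b \<eta> (F_class r D M) N \<Phi> \<le> ereal \<epsilon>"
      using \<open>P n \<epsilon>\<close> unfolding P_def by blast
    have len: "2 * length N \<le> K ^ CARD('d)" using that(3) N(2) by simp
    have "\<kappa> * \<gamma> * R * (R / (8 * real K)) ^ r / (16 * \<delta>) \<le> 2 * \<epsilon>"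
    proof (rule worst_error_lower_bound[OF bf R0 \<delta>0 \<delta>B \<gamma>0 _ \<gamma>B R R2 R_def that(2) assms(1) _ N(1) len err])
      show "\<gamma> \<le> \<delta>" by (simp add: \<gamma>_def)
      show "y \<in> M" if "\<And>j. \<bar>y $ j - \<eta> $ j\<bar> < R\<^sub>0" for y using that by (rule M)
    qed
    moreover have "\<kappa> * \<gamma> * R * (R / (8 * real K)) ^ r / (16 * \<delta>) = c / real K ^ r"
      by (simp add: c_def power_divide power_mult_distrib)
    ultimately show ?thesis by simp
  qed
  define C where "C = (1 / 2) ^ Suc CARD('d) * (c / 4) powr (real CARD('d) / real r)"
  show ?thesis
  proof (rule exI[of _ C], rule conjI)
    show "C > 0" using c by (simp add: C_def)
    show "\<exists>\<epsilon>\<^sub>0>0. \<forall>\<epsilon>. 0 < \<epsilon> \<and> \<epsilon> \<le> \<epsilon>\<^sub>0 \<longrightarrow>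
      ereal_of_enat (comp_nonad a b \<eta> (F_class r D M) (standard_info r) \<epsilon>)
        \<ge> ereal (C * (1 / \<epsilon>) powr (real CARD('d) / real r))"
    proof (rule exI[of _ "c / 4"], intro conjI allI impI)
      show "c / 4 > 0" using c by simp
      fix \<epsilon> :: real assume \<epsilon>: "0 < \<epsilon> \<and> \<epsilon> \<le> c / 4"
      let ?A = "{enat n | n. n \<ge> 1 \<and> P n \<epsilon>}"
      have comp: "comp_nonad a b \<eta> (F_class r D M) (standard_info r) \<epsilon> = Inf ?A"
        by (simp add: comp_nonad_def P_def)
      show "ereal (C * (1 / \<epsilon>) powr (real CARD('d) / real r))
          \<le> ereal_of_enat (comp_nonad a b \<eta> (F_class r D M) (standard_info r) \<epsilon>)"
      proof (cases "?A = {}")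
        case True
        then show ?thesis unfolding comp by (simp only: Inf_enat_def) simp
      next
        case False
        then obtain x where "x \<in> ?A" by blast
        then have "Inf ?A \<in> ?A" unfolding Inf_enat_def using LeastI[of "\<lambda>x. x \<in> ?A" x] by auto
        then obtain n where n: "Inf ?A = enat n" "P n \<epsilon>" by blast
        have "C * (1 / \<epsilon>) powr (real CARD('d) / real r) \<le> real n"
          unfolding C_def
          by (rule complexity_lower_bound_from_rate[where P = P, OF c assms(1) rate])
             (use \<epsilon> n in auto)
        then show ?thesis unfolding comp n(1) by simp
      qed
    qed
  qed
qed

end
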